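(* Assume conditions (A), (B), (C), (D). Then the sequence of processes $\{(Y_k(t))_{t\ge0}\}_{k\ge1}$ is tight in the Skorokhod space $D([0,\infty),\mathbb{R}_+)$.
   Context: Model: for each $k\ge1$, let $\{\xi^{(k)}_{n,i}:n\ge0,i\ge1\}$ be i.i.d. $\mathbb{N}$-valued random variables with probability generating function $g_k$. For each $k$ and $n\ge0$ let $\{\psi^{(n)}_k(i):i\ge0\}$ be an $\mathbb{N}$-valued random function with $\psi^{(n)}_k(i)$ having probability generating function $h_k^{(i)}$; these random functions are i.i.d. in $n$ and independent of the offspring; $Z_k(0)$ is $\mathbb{N}$-valued and independent of everything else. $\phi_k^{(n)}(i)=i+\psi_k^{(n)}(i)$, $Z_k(n+1)=\sum_{i=1}^{\phi_k^{(n)}(Z_k(n))}\xi^{(k)}_{n,i}$. $\gamma_k$ positive constants increasing to $\infty$; $Y_k(t)=Z_k(\lfloor\gamma_kt\rfloor)/k$. Parameters: $b\in\mathbb{R}$, $c\ge0$, $m$ a measure on $(0,\infty)$ with $\int(z\wedge z^2)m(dz)<\infty$, $\pi$ $\sigma$-finite on $(0,\infty)$, Borel $\beta:[0,\infty)\to[0,\infty)$, $q:[0,\infty)\times(0,\infty)\to[0,\infty)$ satisfying (S1) $|\beta(x)|+\int_0^\infty q(x,z)z\pi(dz)\le K(1+x)$ for some $K$ and (S2) $|\beta(x)-\beta(y)|+\int_0^\infty|q(x,z)-q(y,z)|z\pi(dz)\le r(|x-y|)$ for a non-decreasing concave $r\ge0$ with $\int_{0+}r^{-1}=\infty$. $R(\lambda)=b\lambda+c\lambda^2+\int_0^\infty(e^{-\lambda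 z}-1+\lambda z)m(dz)$, $F(\lambda,x)=-\beta(x)\lambda+\int_0^\infty(e^{-\lambda z}-1)q(x,z)\pi(dz)$, $R_k(\lambda)=k\gamma_k[g_k(1-\lambda/k)-(1-\lambda/k)]$, $F_k(\lambda,x)=\gamma_k[h_k^{(\lfloor kx\rfloor)}(1-\lambda/k)-(1-\lambda/k)]$ for $0\le\lambda\le k$. Conditions: (A) $(R_k)$ uniformly Lipschitz on bounded intervals, $R_k\to R$; (B) $F_k\to F$ uniformly on $[0,a_1]\times[0,a_2]$ for all $a_1,a_2>0$; (C) $\frac{\gamma_k}{k}(h_k^{(\lfloor kx\rfloor)})'(1-)\le K_1(1+x)$ for some $K_1>0$, all $x\ge0,k\ge1$; (D) $\sup_k\mathbf{E}[Y_k(0)]<\infty$. *)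

theory Defs
  imports "HOL-Probability.Probability"
begin

primrec Zproc :: "(nat \<Rightarrow> nat \<Rightarrow> nat) \<Rightarrow> (nat \<Rightarrow> nat \<Rightarrow> nat) \<Rightarrow> nat \<Rightarrow> nat \<Rightarrow> nat" where
  "Zproc xi psi z0 0 = z0"
| "Zproc xi psi z0 (Suc n) =
     (let z = Zproc xi psi z0 n in \<Sum>i\<in>{1..z + psi n z}. xi n i)"

definition Ypath :: "(nat \<Rightarrow> nat) \<Rightarrow> real \<Rightarrow> nat \<Rightarrow> real \<Rightarrow> real" where
  "Ypath Z gam k t = (if t < 0 then 0 else real (Z (nat \<lfloor>gam * t\<rfloor>)) / real k)"

definition skorokhod_D :: "(real \<Rightarrow> real) set" where
  "skorokhod_D = {x. (\<forall>t<0. x t = 0) \<and> (\<forall>t\<ge>0. x t \<ge> 0)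
      \<and> (\<forall>t\<ge>0. (x \<longlongrightarrow> x t) (at_right t))
      \<and> (\<forall>t>0. \<exists>l. (x \<longlongrightarrow> l) (at_left t))}"

definition time_changes :: "(real \<Rightarrow> real) set" where
  "time_changes = {l. continuous_on {0..} l \<and> strict_mono_on {0..} l \<and> l ` {0..} = {0..}}"

text \<open>Convergence in the Skorokhod J1 topology on D([0,oo)) (Billingsley, Thm 16.2).\<close>
definition skorokhod_conv :: "(nat \<Rightarrow> real \<Rightarrow> real) \<Rightarrow> (real \<Rightarrow> real) \<Rightarrow> bool" where
  "skorokhod_conv xs x \<longleftrightarrow>
     (\<exists>lam. (\<forall>n. lam n \<in> time_changes)
        \<and> (\<forall>e>0. eventually (\<lambda>n. \<forall>t\<ge>0. \<bar>lam n t - t\<bar> \<le> e) sequentially)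
        \<and> (\<forall>T>0. \<forall>e>0. eventually (\<lambda>n. \<forall>t\<in>{0..T}. \<bar>xs n (lam n t) - x t\<bar> \<le> e) sequentially))"

text \<open>Compact subsets of the (metrizable) Skorokhod space = sequentially compact ones.\<close>
definition skorokhod_compact :: "(real \<Rightarrow> real) set \<Rightarrow> bool" where
  "skorokhod_compact K \<longleftrightarrow> K \<subseteq> skorokhod_D \<and>
     (\<forall>xs::nat \<Rightarrow> real \<Rightarrow> real. (\<forall>n. xs n \<in> K) \<longrightarrow> (\<exists>(r::nat \<Rightarrow> nat) x. strict_mono r \<and> x \<in> K \<and> skorokhod_conv (xs \<circ> r) x))"

text \<open>Tightness of the laws of the D-valued random elements Y k, k >= 1
  (probability of {Y k \<in> K} taken as inner probability to avoid measurability side issues).\<close>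
definition skorokhod_tight :: "'a measure \<Rightarrow> (nat \<Rightarrow> 'a \<Rightarrow> real \<Rightarrow> real) \<Rightarrow> bool" where
  "skorokhod_tight M Y \<longleftrightarrow>
     (\<forall>e>0. \<exists>KK. skorokhod_compact KK \<and>
        (\<forall>k\<ge>1. \<exists>A\<in>sets M. A \<subseteq> {w\<in>space M. Y k w \<in> KK} \<and> measure M A \<ge> 1 - e))"

end

theory Submission
  imports Defs
begin

text \<open>Fix \<open>k\<close> and put \<open>X = Z / k\<close>. The Lipschitz bound on \<open>R\<^sub>k\<close> and the bound on the mean immigration say that
one step of the chain changes \<open>1 + X\<close> by a factor of at most \<open>1 + C / \<gamma>\<^sub>k\<close> in mean, and changes the
expectation of \<open>exp (- X)\<close> and \<open>exp (- 2 X)\<close> by \<open>O(1 / \<gamma>\<^sub>k)\<close> as long as \<open>X\<close> is bounded; the variance of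
the offspring, which may be infinite, never enters. The first bound gives compact containment by the
maximal inequality. The second bounds the drift of \<open>(exp (- X) - exp (- X\<^sub>r\<^sub>e\<^sub>f))\<^sup>2\<close>, where \<open>X\<^sub>r\<^sub>e\<^sub>f\<close> is reset to
\<open>X\<close> as soon as \<open>exp (- X)\<close> has moved by \<open>\<eta>\<close>. A Lyapunov function built from it shows that two
resets within \<open>\<delta>\<close> time units have probability \<open>O(\<delta>)\<close>, uniformly in \<open>k\<close>. The reset times are
therefore a \<open>\<delta>\<close>-sparse partition on whose blocks the path oscillates little, and sets of paths with
such partitions are compact in the Skorokhod space.\<close>

section \<open>A family of compact sets in the Skorokhod space\<close>

text \<open>The Lipschitz bound on R_k, together with R_k(0) = 0, controls g_k only to first order
  at 1. It yields bounds on Laplace transforms at fixed arguments, so displacement has to be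
  measured by a bounded function of the path whose square stays in the span of such transforms. The
  squared distance of \<open>exp (- X)\<close> to a frozen value is affine in
  \<open>exp (- X)\<close> and \<open>exp (- 2 X)\<close>; this is why the arguments 1 and 2 occur,
  and why condition (A) is used on the interval [0, 2]. The price is that closeness of
  \<open>exp (- X)\<close> means closeness of X only below a level a, and costs a factor
  \<open>exp a\<close>. Hence the level is fixed before the threshold, and oscillations are
  estimated only while the level has not been exceeded. Drifts are of order 1 / gam per step, and a
  horizon H contains at most gam * H steps. The factor gam therefore cancels, and the bounds hold
  for every k >= 1 instead of only for large k.\<close>

lemma partition_block:
  fixes t :: "nat \<Rightarrow> real"
  assumes "t 0 = 0" "\<And>i. t i + d \<le> t (Suc i)" "d > 0" "s \<ge> 0"
  obtains i where "t i \<le> s" "s < t (Suc i)"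
proof -
  have lower: "real i * d \<le> t i" for i
  proof (induction i)
    case (Suc i) then show ?case using assms(2)[of i] by (simp add: algebra_simps)
  qed (simp add: assms)
  obtain N :: nat where "s < real N * d" using assms(3) reals_Archimedean3 by blast
  hence ex: "\<exists>i. s < t i" using lower[of N] by (intro exI[of _ N]) linarith
  define i where "i = (LEAST i. s < t i)"
  have i: "s < t i" unfolding i_def using ex by (rule LeastI_ex)
  have "i \<noteq> 0" using i assms(1,4) by (cases i) auto
  then obtain i' where i': "i = Suc i'" using not0_implies_Suc by blast
  have "\<not> s < t i'" using not_less_Least[of i' "\<lambda>i. s < t i"] i' i_def by auto
  thus ?thesis using that[of i'] i i' by auto
qed

lemma partition_mono:
  fixes t :: "nat \<Rightarrow> real"
  assumes "\<And>i. t i + d \<le> t (Suc i)" "d > 0" "i < j"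
  shows "t i + d \<le> t j"
  using assms(3)
proof (induction j)
  case (Suc j)
  show ?case
  proof (cases "i = j")
    case True thus ?thesis using assms(1) by auto
  next
    case False thus ?thesis using Suc assms(1)[of j] assms(2) by auto
  qed
qed simp

text \<open>Carries the block endpoints of a limit path onto those of an approximating path, so that
  the two paths can be compared block by block. Each hat has slope at most 2 / d, so the correction
  added to the identity has Lipschitz constant below 1 once the shifts sum to less than d /
  2.\<close>

lemma time_change_interpolation:
  fixes t s :: "nat \<Rightarrow> real"
  assumes t0: "t 0 = 0" and s0: "s 0 = 0" and gap: "\<And>i. t i + d \<le> t (Suc i)" and d: "d > 0"
    and small: "(\<Sum>i\<le>I. \<bar>s i - t i\<bar>) < d / 2"
  obtains l where "l \<in> time_changes" "\<And>u. \<bar>l u - u\<bar> \<le> (\<Sum>i\<le>I. \<bar>s i - t i\<bar>)"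
    "\<And>i. i \<le> I \<Longrightarrow> l (t i) = s i"
proof -
  \<comment> \<open>The hats have disjoint supports, and small heights keep \<open>l\<close> strictly increasing.\<close>
  define hat where "hat i u = max 0 (1 - \<bar>u - t i\<bar> / (d/2))" for i u
  define l where "l u = u + (\<Sum>i\<le>I. (s i - t i) * hat i u)" for u
  have hat01: "0 \<le> hat i u" "hat i u \<le> 1" for i u using d by (auto simp: hat_def)
  have hat_lip: "\<bar>hat i u - hat i v\<bar> \<le> \<bar>u - v\<bar> / (d/2)" for i u v
  proof -
    have "\<bar>\<bar>u - t i\<bar> / (d/2) - \<bar>v - t i\<bar> / (d/2)\<bar> \<le> \<bar>u - v\<bar> / (d/2)"
      unfolding diff_divide_distrib[symmetric] abs_divide using d
      by (intro divide_mono) auto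
    moreover have "\<bar>max 0 (1 - A) - max 0 (1 - B)\<bar> \<le> \<bar>A - B\<bar>" for A B :: real by linarith
    ultimately show ?thesis unfolding hat_def by (meson order_trans)
  qed
  have dist: "i \<noteq> j \<Longrightarrow> \<bar>t i - t j\<bar> \<ge> d" for i j
    using partition_mono[of t d i j, OF gap d] partition_mono[of t d j i, OF gap d]
    by (cases i j rule: linorder_cases) auto
  have hat_eq: "hat i (t j) = (if i = j then 1 else 0)" for i j
    using dist[of j i] d by (auto simp: hat_def field_simps max_def)
  have l_at: "l (t i) = s i" if "i \<le> I" for i
    using that by (simp add: l_def hat_eq if_distrib sum.delta cong: if_cong)
  define S where "S = (\<Sum>i\<le>I. \<bar>s i - t i\<bar>)"
  have S0: "S \<ge> 0" unfolding S_def by (intro sum_nonneg) auto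
  have l_near: "\<bar>l u - u\<bar> \<le> S" for u
  proof -
    have "\<bar>l u - u\<bar> \<le> (\<Sum>i\<le>I. \<bar>(s i - t i) * hat i u\<bar>)" unfolding l_def by (simp add: sum_abs)
    also have "\<dots> \<le> S" unfolding S_def abs_mult using hat01
      by (intro sum_mono mult_left_le) (auto simp: )
    finally show ?thesis .
  qed
  have l_mono: "l u < l v" if "u < v" for u v
  proof -
    have "\<bar>(l v - v) - (l u - u)\<bar> = \<bar>\<Sum>i\<le>I. (s i - t i) * (hat i v - hat i u)\<bar>"
      by (simp add: l_def right_diff_distrib sum_subtractf)
    also have "\<dots> \<le> (\<Sum>i\<le>I. \<bar>(s i - t i) * (hat i v - hat i u)\<bar>)" by (rule sum_abs)
    also have "\<dots> \<le> (\<Sum>i\<le>I. \<bar>s i - t i\<bar> * (\<bar>v - u\<bar> / (d/2)))"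
      unfolding abs_mult by (intro sum_mono mult_left_mono hat_lip) auto
    also have "\<dots> = S * (\<bar>v - u\<bar> / (d/2))" unfolding S_def by (rule sum_distrib_right[symmetric])
    also have "\<dots> < (d/2) * (\<bar>v - u\<bar> / (d/2))"
      using small that d unfolding S_def[symmetric] by (intro mult_strict_right_mono) auto
    also have "\<dots> = v - u" using d that by simp
    finally show ?thesis by linarith
  qed
  have cont: "continuous_on A l" for A
    unfolding l_def hat_def using d by (intro continuous_intros) auto
  have l00: "l 0 = 0" using l_at[of 0] t0 s0 by auto
  have "l ` {0..} = {0..}"
  proof
    show "l ` {0..} \<subseteq> {0..}"
    proof clarsimp
      fix u :: real assume "0 \<le> u"
      thus "0 \<le> l u" using l_mono[of 0 u] l00 by (cases "u = 0") auto
    qed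
    show "{0..} \<subseteq> l ` {0..}"
    proof
      fix y :: real assume y: "y \<in> {0..}"
      have "l (y + S) \<ge> y" using l_near[of "y + S"] by linarith
      then obtain u where "0 \<le> u" "u \<le> y + S" "l u = y"
        using IVT'[of l 0 y "y + S"] l00 y S0 cont by auto
      thus "y \<in> l ` {0..}" by auto
    qed
  qed
  hence "l \<in> time_changes"
    unfolding time_changes_def using cont l_mono by (auto simp: strict_mono_on_def)
  thus ?thesis using that l_near l_at unfolding S_def by blast
qed

section \<open>Assembling time changes into Skorokhod convergence\<close>

lemma id_time_change: "(\<lambda>t. t) \<in> time_changes"
  by (auto simp: time_changes_def strict_mono_on_def)

lemma inverse_Suc_small:
  fixes e T :: real assumes "e > 0"
  obtains m :: nat where "1 / real (Suc m) \<le> e" "T \<le> real m"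
proof -
  obtain m where m: "real m \<ge> max T (1/e)" using real_arch_simple by blast
  have "1/e \<le> real (Suc m)" using m by auto
  hence "1 / real (Suc m) \<le> e" using assms by (simp add: field_simps)
  thus ?thesis using m that by auto
qed

text \<open>\<open>skorokhod_conv\<close> wants one sequence of time changes that is good at all
  precisions and horizons, whereas the hypothesis gives one per precision. For each n the witness at
  the largest solvable level m <= n is taken. The cap n makes a largest level exist, and any fixed
  level is below it eventually.\<close>

lemma skorokhod_convI:
  assumes "\<And>e H. e > 0 \<Longrightarrow> eventually (\<lambda>n. \<exists>l\<in>time_changes.
      (\<forall>t\<ge>0. \<bar>l t - t\<bar> \<le> e) \<and> (\<forall>t\<in>{0..H}. \<bar>X n (l t) - x t\<bar> \<le> e)) sequentially"
  shows "skorokhod_conv X x"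
proof -
  define Q where "Q m n l \<longleftrightarrow> l \<in> time_changes \<and> (\<forall>t\<ge>0. \<bar>l t - t\<bar> \<le> 1 / real (Suc m)) \<and>
     (\<forall>t\<in>{0..real m}. \<bar>X n (l t) - x t\<bar> \<le> 1 / real (Suc m))" for m n l
  have Q_mono: "Q m n l" if "Q m' n l" "m \<le> m'" for m m' n l
  proof -
    have "1 / real (Suc m') \<le> 1 / real (Suc m)" using that by (simp add: frac_le)
    thus ?thesis using that unfolding Q_def by (auto intro: order_trans)
  qed
  have ev: "eventually (\<lambda>n. \<exists>l. Q m n l) sequentially" for m
    using assms[of "1 / real (Suc m)" "real m"] unfolding Q_def by (simp add: Bex_def)
  have "\<exists>l. l \<in> time_changes \<and> (\<forall>m\<le>n. (\<exists>l'. Q m n l') \<longrightarrow> Q m n l)" for n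
  proof (cases "\<exists>m\<le>n. \<exists>l'. Q m n l'")
    case True
    define M where "M = (GREATEST m. m \<le> n \<and> (\<exists>l'. Q m n l'))"
    have M: "M \<le> n \<and> (\<exists>l'. Q M n l')"
      unfolding M_def
      by (rule GreatestI_ex_nat[of "\<lambda>m. m \<le> n \<and> (\<exists>l'. Q m n l')" n]) (use True in blast)+
    then obtain l where l: "Q M n l" by auto
    have "Q m n l" if "m \<le> n" "\<exists>l'. Q m n l'" for m
    proof (rule Q_mono[OF l])
      show "m \<le> M" unfolding M_def
        by (rule Greatest_le_nat[of "\<lambda>m. m \<le> n \<and> (\<exists>l'. Q m n l')" _ n]) (use that in blast)+
    qed
    moreover have "l \<in> time_changes" using l unfolding Q_def by auto
    ultimately show ?thesis by blast
  next
    case False thus ?thesis using id_time_change by blast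
  qed
  then obtain lam where lam: "\<And>n. lam n \<in> time_changes"
    "\<And>n m. m \<le> n \<Longrightarrow> (\<exists>l'. Q m n l') \<Longrightarrow> Q m n (lam n)" by metis
  have ev_lam: "eventually (\<lambda>n. Q m n (lam n)) sequentially" for m
    using ev[of m] eventually_ge_at_top[of m] by eventually_elim (auto intro: lam(2))
  show ?thesis unfolding skorokhod_conv_def
  proof (rule exI[of _ lam], intro conjI allI impI lam(1))
    fix e :: real assume "e > 0"
    then obtain m :: nat where m: "1 / real (Suc m) \<le> e" using inverse_Suc_small by blast
    show "eventually (\<lambda>n. \<forall>t\<ge>0. \<bar>lam n t - t\<bar> \<le> e) sequentially"
      using ev_lam[of m] by eventually_elim (use m in \<open>auto simp: Q_def intro: order_trans\<close>)
  next
    fix T e :: real assume "e > 0"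
    then obtain m :: nat where m: "1 / real (Suc m) \<le> e" "T \<le> real m"
      using inverse_Suc_small by blast
    show "eventually (\<lambda>n. \<forall>t\<in>{0..T}. \<bar>X n (lam n t) - x t\<bar> \<le> e) sequentially"
      using ev_lam[of m] 
      by eventually_elim (use m in \<open>auto simp: Q_def intro: order_trans[OF _ m(1)]\<close>)
  qed
qed

text \<open>Partitions are infinite sequences, with filler points beyond the horizon
  \<open>H\<close>, so that all paths share one index set. The upper bound on \<open>t i\<close>
  confines each point to a compact interval that does not depend on the path. All inequalities on
  \<open>t\<close> and \<open>y\<close> are weak and so survive limits.\<close>

definition block_approx ::
    "real \<Rightarrow> real \<Rightarrow> real \<Rightarrow> real \<Rightarrow> (real \<Rightarrow> real) \<Rightarrow> (nat \<Rightarrow> real) \<Rightarrow> (nat \<Rightarrow> real) \<Rightarrow> bool" where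
  "block_approx H d e a x t y \<longleftrightarrow> t 0 = 0 \<and> (\<forall>i. t i + d \<le> t (Suc i)) \<and> (\<forall>i. t i \<le> H + real i * d)
     \<and> (\<forall>i. 0 \<le> y i \<and> y i \<le> a)
     \<and> (\<forall>i s. t i \<le> s \<longrightarrow> s < t (Suc i) \<longrightarrow> s < H \<longrightarrow> \<bar>x s - y i\<bar> \<le> e)"

text \<open>The blocks are described by centres \<open>y\<close> rather than by oscillations, so that the condition
  passes to limits with the same constants.\<close>

definition block_paths :: "(nat \<Rightarrow> real) \<Rightarrow> (nat \<Rightarrow> real) \<Rightarrow> (real \<Rightarrow> real) set" where
  "block_paths d a = {x \<in> skorokhod_D.
     \<forall>j. \<exists>t y. block_approx (real j) (d j) (1 / real (Suc j)) (a j) x t y}"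

text \<open>The limit path is rebuilt from the limits of the centres. At time s the level-j centre
  is a Cauchy sequence in j, because centres of overlapping blocks at two levels differ by at most
  the sum of the two precisions. Convergence then follows by aligning the partitions of a single,
  sufficiently fine level.\<close>

lemma block_approx_limit:
  fixes X :: "nat \<Rightarrow> real \<Rightarrow> real"
  assumes d: "\<And>j. d j > 0"
    and blk: "\<And>n j. block_approx (real j) (d j) (1 / real (Suc j)) (a j) (X n) (T n j) (Y n j)"
    and T: "\<And>j i. (\<lambda>n. T n j i) \<longlonglongrightarrow> t j i"
    and Y: "\<And>j i. (\<lambda>n. Y n j i) \<longlonglongrightarrow> y j i"
  shows "\<exists>x\<in>block_paths d a. skorokhod_conv X x"
proof -
  define e where "e j = 1 / real (Suc j)" for j
  have e_lim: "e \<longlonglongrightarrow> 0" unfolding e_def using LIMSEQ_Suc[OF lim_1_over_n] by simp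
  have T0: "T n j 0 = 0" and Tgap: "T n j i + d j \<le> T n j (Suc i)"
    and Tle: "T n j i \<le> real j + real i * d j" and Y0: "0 \<le> Y n j i" and Ya: "Y n j i \<le> a j" for n j i
    using blk[of j n] unfolding block_approx_def by auto
  have Yapp: "\<bar>X n s - Y n j i\<bar> \<le> e j"
    if "T n j i \<le> s" "s < T n j (Suc i)" "s < real j" for n j i s
    using blk[of j n] that unfolding block_approx_def e_def by auto
  have t0: "t j 0 = 0" for j using LIMSEQ_unique[OF T[of j 0], of 0] by (simp add: T0)
  have tgap: "t j i + d j \<le> t j (Suc i)" for j i
    by (rule LIMSEQ_le[OF tendsto_add[OF T tendsto_const] T]) (use Tgap in auto)
  have tle: "t j i \<le> real j + real i * d j" for j i
    by (rule LIMSEQ_le_const2[OF T]) (use Tle in auto)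
  have y0: "0 \<le> y j i" for j i
    by (rule LIMSEQ_le_const[OF Y]) (use Y0 in auto)
  have ya: "y j i \<le> a j" for j i
    by (rule LIMSEQ_le_const2[OF Y]) (use Ya in auto)
  have cmp: "\<bar>y j i - y j' i'\<bar> \<le> e j + e j'"
    if s: "t j i \<le> s" "s < t j (Suc i)" "t j' i' \<le> s" "s < t j' (Suc i')" "s < real j" "s < real j'"
    for j i j' i' s
  proof -
    \<comment> \<open>\<open>s\<close> may be a left endpoint; slightly to its right both blocks persist along the sequence.\<close>
    obtain u where u: "s < u" "u < Min {t j (Suc i), t j' (Suc i'), real j, real j'}"
      using dense[of s "Min {t j (Suc i), t j' (Suc i'), real j, real j'}"] s by auto
    have lt: "T n j i < u \<Longrightarrow> u < T n j (Suc i) \<Longrightarrow> T n j' i' < u \<Longrightarrow> u < T n j' (Suc i') \<Longrightarrow>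
        \<bar>Y n j i - Y n j' i'\<bar> \<le> e j + e j'" for n
      using Yapp[of n j i u] Yapp[of n j' i' u] u by auto
    have ev1: "eventually (\<lambda>n. T n j i < u) sequentially" "eventually (\<lambda>n. T n j' i' < u) sequentially"
      using s u by (auto intro!: order_tendstoD(2)[OF T])
    have ev2: "eventually (\<lambda>n. u < T n j (Suc i)) sequentially" "eventually (\<lambda>n. u < T n j' (Suc i')) sequentially"
      using s u by (auto intro!: order_tendstoD(1)[OF T])
    have "eventually (\<lambda>n. \<bar>Y n j i - Y n j' i'\<bar> \<le> e j + e j') sequentially"
      using ev1(1) ev2(1) ev1(2) ev2(2) by eventually_elim (rule lt)
    thus ?thesis
      by (intro tendsto_upperbound[OF tendsto_rabs[OF tendsto_diff[OF Y Y]]]) auto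
  qed
  have "\<exists>i. t j i \<le> s \<and> s < t j (Suc i)" if "s \<ge> 0" for j s
    using partition_block[of "t j" "d j" s] t0 tgap d that by metis
  hence "\<forall>j s. \<exists>i. s \<ge> 0 \<longrightarrow> t j i \<le> s \<and> s < t j (Suc i)" by blast
  then obtain p where p: "\<And>j s. s \<ge> 0 \<Longrightarrow> t j (p j s) \<le> s \<and> s < t j (Suc (p j s))" by metis
  define x where "x s = (if s < 0 then 0 else lim (\<lambda>j. y j (p j s)))" for s
  have x_lim: "(\<lambda>j. y j (p j s)) \<longlonglongrightarrow> x s" if "s \<ge> 0" for s
  proof -
    have "Cauchy (\<lambda>j. y j (p j s))"
    proof (rule metric_CauchyI)
      fix r :: real assume "r > 0"
      then obtain m :: nat where m: "1 / real (Suc m) \<le> r / 3" "s + 1 \<le> real m"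
        using inverse_Suc_small[of "r/3" "s+1"] by auto
      have em: "e j \<le> r / 3" if "j \<ge> m" for j
      proof -
        have "1 / real (Suc j) \<le> 1 / real (Suc m)" using that by (intro divide_left_mono) auto
        thus ?thesis using m(1) unfolding e_def by linarith
      qed
      have "dist (y j (p j s)) (y j' (p j' s)) < r" if "j \<ge> m" "j' \<ge> m" for j j'
      proof -
        have "real m \<le> real j" "real m \<le> real j'" using that by auto
        hence "\<bar>y j (p j s) - y j' (p j' s)\<bar> \<le> e j + e j'"
          using p[OF \<open>s \<ge> 0\<close>] m(2) by (intro cmp[of j _ s j']) auto
        thus ?thesis using em[OF that(1)] em[OF that(2)] \<open>r > 0\<close> by (simp add: dist_real_def)
      qed
      thus "\<exists>M. \<forall>j\<ge>M. \<forall>j'\<ge>M. dist (y j (p j s)) (y j' (p j' s)) < r" by blast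
    qed
    thus ?thesis using that by (simp add: x_def Cauchy_convergent_iff convergent_LIMSEQ_iff)
  qed
  have xapp: "\<bar>x s - y j i\<bar> \<le> e j" if s: "s \<ge> 0" "t j i \<le> s" "s < t j (Suc i)" "s < real j" for j i s
  proof -
    have "eventually (\<lambda>j'. s < real j') sequentially"
      using filterlim_real_sequentially by (simp add: filterlim_at_top_dense)
    hence "eventually (\<lambda>j'. \<bar>y j' (p j' s) - y j i\<bar> \<le> e j' + e j) sequentially"
      by eventually_elim (rule cmp, use p s in auto)
    moreover have "(\<lambda>j'. e j' + e j) \<longlonglongrightarrow> 0 + e j" by (intro tendsto_intros e_lim)
    ultimately show ?thesis
      by (intro tendsto_le[OF _ _ tendsto_rabs[OF tendsto_diff[OF x_lim tendsto_const]]]) (use s in auto)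
  qed
  have t_ge0: "t j i \<ge> 0" for j i
    using partition_mono[of "t j" "d j" 0 i] tgap[of j] d[of j] t0[of j] by (cases i) auto
  have xblk: "block_approx (real j) (d j) (1 / real (Suc j)) (a j) x (t j) (y j)" for j
    unfolding block_approx_def e_def[symmetric] using t0 tgap tle y0 ya
    by (auto intro!: xapp order_trans[OF t_ge0])
  have "x \<in> skorokhod_D"
    unfolding skorokhod_D_def
  proof (safe)
    fix s :: real
    show "s < 0 \<Longrightarrow> x s = 0" by (simp add: x_def)
    show "0 \<le> x s" if "s \<ge> 0" using LIMSEQ_le_const[OF x_lim[OF that]] y0 by auto
    show "(x \<longlongrightarrow> x s) (at_right s)" if s: "s \<ge> 0"
    proof (rule tendstoI)
      fix r :: real assume r: "r > 0"
      obtain j :: nat where j: "1 / real (Suc j) \<le> r/3" "s + 1 \<le> real j"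
        using inverse_Suc_small[of "r/3" "s + 1"] r by auto
      have "eventually (\<lambda>u. u < min (t j (Suc (p j s))) (real j)) (at_right s)"
        using p[OF s, of j] j by (intro order_tendstoD[OF tendsto_ident_at]) auto
      thus "eventually (\<lambda>u. dist (x u) (x s) < r) (at_right s)"
        using eventually_at_right_less[of s]
      proof eventually_elim
        case (elim u)
        have "\<bar>x u - y j (p j s)\<bar> \<le> e j" "\<bar>x s - y j (p j s)\<bar> \<le> e j"
          using elim p[OF s, of j] s j by (auto intro!: xapp)
        thus ?case using j r unfolding dist_real_def e_def by linarith
      qed
    qed
    show "\<exists>l. (x \<longlongrightarrow> l) (at_left s)" if s: "s > 0"
    proof -
      have "cauchy_filter (filtermap x (at_left s))"
        unfolding cauchy_filter_metric_filtermap
      proof (intro allI impI)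
        fix r :: real assume r: "r > 0"
        obtain j :: nat where j: "1 / real (Suc j) \<le> r/3" "s + 1 \<le> real j"
          using inverse_Suc_small[of "r/3" "s + 1"] r by auto
        \<comment> \<open>For the left limit the block just before s is needed. If s is itself a
          partition point, this is the preceding block.\<close>
        have "\<exists>i. t j i < s \<and> s \<le> t j (Suc i)"
        proof (cases "t j (p j s) = s")
          case True
          then obtain i where i: "p j s = Suc i" using t0[of j] s by (cases "p j s") auto
          show ?thesis using True i tgap[of j i] d[of j] by (intro exI[of _ i]) auto
        next
          case False thus ?thesis using p[of s j] s by (intro exI[of _ "p j s"]) auto
        qed
        then obtain i where i: "t j i < s" "s \<le> t j (Suc i)" by auto
        have "dist (x u) (x v) < r" if "u \<in> {t j i<..<s}" "v \<in> {t j i<..<s}" for u v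
        proof -
          have "\<bar>x u - y j i\<bar> \<le> e j" "\<bar>x v - y j i\<bar> \<le> e j"
            using that i t_ge0[of j i] s j by (auto intro!: xapp)
          thus ?thesis using j r unfolding dist_real_def e_def by linarith
        qed
        moreover have "eventually (\<lambda>u. u \<in> {t j i<..<s}) (at_left s)"
          using eventually_at_left_real[OF i(1)] .
        ultimately show "\<exists>P. eventually P (at_left s) \<and> (\<forall>u v. P u \<and> P v \<longrightarrow> dist (x u) (x v) < r)"
          by (intro exI[of _ "\<lambda>u. u \<in> {t j i<..<s}"]) auto
      qed
      moreover have "filtermap x (at_left s) \<noteq> bot" by (simp add: filtermap_bot_iff)
      ultimately obtain l where "filtermap x (at_left s) \<le> nhds l"
        using complete_uniform[of "UNIV :: real set"] complete_UNIV by (auto)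
      thus ?thesis unfolding filterlim_def by blast
    qed
  qed
  hence xK: "x \<in> block_paths d a" unfolding block_paths_def using xblk by blast
  have "skorokhod_conv X x"
  proof (rule skorokhod_convI)
    fix r H :: real assume r: "r > 0"
    \<comment> \<open>Three errors of at most r / 4 will be added: two block approximations and one
      difference of centres. The time change moves points by less than 1, so times up to H stay
      below the horizon j. Only blocks with index below \<open>I\<close> meet the interval from 0 to
      H.\<close>
    obtain j :: nat where j: "1 / real (Suc j) \<le> r/4" "H + 2 \<le> real j"
      using inverse_Suc_small[of "r/4" "H + 2"] r by auto
    obtain I :: nat where I: "H < real I * d j" using d reals_Archimedean3 by blast
    have tI: "real i * d j \<le> t j i" for i
    proof (induction i)
      case (Suc i) then show ?case using tgap[of j i] by (simp add: algebra_simps)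
    qed (simp add: t0)
    define S where "S n = (\<Sum>i\<le>I. \<bar>T n j i - t j i\<bar>)" for n
    have "S \<longlonglongrightarrow> (\<Sum>i\<le>I. \<bar>t j i - t j i\<bar>)" unfolding S_def
      by (intro tendsto_intros T)
    hence S: "S \<longlonglongrightarrow> 0" by simp
    have evS: "eventually (\<lambda>n. S n < Min {d j / 2, r, 1}) sequentially"
      by (rule order_tendstoD(2)[OF S]) (use d[of j] r in auto)
    have "eventually (\<lambda>n. \<bar>Y n j i - y j i\<bar> < r/4) sequentially" for i
      using tendstoD[OF Y, of "r/4"] r by (simp add: dist_real_def)
    hence evY: "eventually (\<lambda>n. \<forall>i\<in>{..I}. \<bar>Y n j i - y j i\<bar> < r/4) sequentially"
      by (intro eventually_ball_finite) auto
    show "eventually (\<lambda>n. \<exists>l\<in>time_changes. (\<forall>t\<ge>0. \<bar>l t - t\<bar> \<le> r) \<and>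
        (\<forall>t\<in>{0..H}. \<bar>X n (l t) - x t\<bar> \<le> r)) sequentially"
      using evS evY
    proof eventually_elim
      case (elim n)
      have Sn: "(\<Sum>i\<le>I. \<bar>T n j i - t j i\<bar>) < d j / 2" using elim(1) unfolding S_def by simp
      obtain l where l: "l \<in> time_changes" "\<And>u. \<bar>l u - u\<bar> \<le> S n" "\<And>i. i \<le> I \<Longrightarrow> l (t j i) = T n j i"
        unfolding S_def
        by (rule time_change_interpolation[of "t j" "T n j" "d j" I, OF t0 T0 tgap d Sn])
          (use that in blast)
      have lmono: "l u < l v" if "0 \<le> u" "u < v" for u v
        using l(1) that by (auto simp: time_changes_def strict_mono_on_def)
      have "\<bar>X n (l s) - x s\<bar> \<le> r" if s: "s \<in> {0..H}" for s
      proof -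
        define i where "i = p j s"
        have i: "t j i \<le> s" "s < t j (Suc i)" using p s unfolding i_def by auto
        have iI: "i < I"
        proof (rule ccontr)
          assume "\<not> i < I"
          hence "real I * d j \<le> real i * d j" using d[of j] by (intro mult_right_mono) auto
          thus False using tI[of i] i I s by auto
        qed
        have "T n j i \<le> l s" using l(3)[of i] iI lmono[of "t j i" s] t_ge0[of j i] i
          by (cases "t j i = s") auto
        moreover have "l s < T n j (Suc i)"
          using l(3)[of "Suc i"] iI lmono[of s "t j (Suc i)"] s i by auto
        moreover have "l s < real j" using l(2)[of s] elim(1) s j(2) by auto
        ultimately have "\<bar>X n (l s) - Y n j i\<bar> \<le> e j" by (rule Yapp)
        moreover have "\<bar>x s - y j i\<bar> \<le> e j" using i s j by (intro xapp) auto
        moreover have "\<bar>Y n j i - y j i\<bar> < r/4" using elim(2) iI by auto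
        ultimately show ?thesis using j(1) unfolding e_def by linarith
      qed
      moreover have "\<bar>l u - u\<bar> \<le> r" for u using l(2)[of u] elim(1) by auto
      ultimately show ?case using l(1) by blast
    qed
  qed
  thus ?thesis using xK by blast
qed

lemma block_approx_nonneg_partition:
  assumes "block_approx H d e a x t y" "d > 0"
  shows "t i \<ge> 0"
  using partition_mono[of t d 0 i] assms unfolding block_approx_def by (cases i) auto

text \<open>Partition points and centres of all levels form one point in a countable product of
  compact rectangles. Sequential compactness of that product extracts a single subsequence for all
  levels and indices, in place of an explicit diagonal argument.\<close>

lemma block_paths_compact:
  assumes d: "\<And>j. d j > 0"
  shows "skorokhod_compact (block_paths d a)"
  unfolding skorokhod_compact_def
proof (intro conjI allI impI)
  show "block_paths d a \<subseteq> skorokhod_D" by (auto simp: block_paths_def)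
  fix xs :: "nat \<Rightarrow> real \<Rightarrow> real" assume "\<forall>n. xs n \<in> block_paths d a"
  hence "\<forall>n j. \<exists>t y. block_approx (real j) (d j) (1 / real (Suc j)) (a j) (xs n) t y"
    by (auto simp: block_paths_def)
  then obtain T Y where
    TY: "\<And>n j. block_approx (real j) (d j) (1 / real (Suc j)) (a j) (xs n) (T n j) (Y n j)" by metis
  define F where "F n = (\<lambda>(j, i). (T n j i, Y n j i))" for n
  define C where "C = (\<lambda>(j, i). {0..real j + real i * d j} \<times> {0..a j})"
  have "compactin (product_topology (\<lambda>_. euclidean) UNIV) (PiE UNIV C)"
    unfolding compactin_PiE by (auto simp: C_def compact_Times)
  hence "compact (PiE UNIV C)" by (simp add: euclidean_product_topology)
  hence "seq_compact (PiE UNIV C)" by (rule compact_imp_seq_compact)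
  moreover have "F n \<in> PiE UNIV C" for n
    using TY[of _ n] block_approx_nonneg_partition[OF TY d, of n]
    by (auto simp: F_def C_def block_approx_def PiE_def)
  ultimately obtain L r where r: "strict_mono (r :: nat \<Rightarrow> nat)" "(F \<circ> r) \<longlonglongrightarrow> L"
    unfolding seq_compact_def by metis
  have FL: "(\<lambda>n. F (r n) (j, i)) \<longlonglongrightarrow> L (j, i)" for j i
    using continuous_on_tendsto_compose[OF continuous_on_product_coordinates[of "(j, i)"] r(2)]
    by (simp add: o_def)
  have lims: "(\<lambda>n. T (r n) j i) \<longlonglongrightarrow> fst (L (j, i))" "(\<lambda>n. Y (r n) j i) \<longlonglongrightarrow> snd (L (j, i))" for j i
    using tendsto_fst[OF FL[of j i]] tendsto_snd[OF FL[of j i]] by (simp_all add: F_def)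
  have "\<exists>x\<in>block_paths d a. skorokhod_conv (\<lambda>n. xs (r n)) x"
    by (rule block_approx_limit[where T = "\<lambda>n. T (r n)" and Y = "\<lambda>n. Y (r n)"
         and t = "\<lambda>j i. fst (L (j, i))" and y = "\<lambda>j i. snd (L (j, i))", OF d TY lims])
  thus "\<exists>(r :: nat \<Rightarrow> nat) x. strict_mono r \<and> x \<in> block_paths d a \<and> skorokhod_conv (xs \<circ> r) x"
    using r(1) by (auto simp: o_def)
qed

section \<open>Oscillation blocks of rescaled integer paths\<close>

lemma Ypath_skorokhod_D:
  assumes "gam > 0"
  shows "Ypath z gam k \<in> skorokhod_D"
proof -
  let ?x = "Ypath z gam k"
  have const: "?x u = ?x v" if "u \<ge> 0" "v \<ge> 0" "\<lfloor>gam * u\<rfloor> = \<lfloor>gam * v\<rfloor>" for u v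
    using that by (simp add: Ypath_def)
  show ?thesis unfolding skorokhod_D_def
  proof safe
    fix t :: real
    show "t < 0 \<Longrightarrow> ?x t = 0" "0 \<le> t \<Longrightarrow> 0 \<le> ?x t" by (auto simp: Ypath_def)
    show "(?x \<longlongrightarrow> ?x t) (at_right t)" if t: "t \<ge> 0"
    proof (rule tendsto_eventually)
      have "t < (of_int \<lfloor>gam * t\<rfloor> + 1) / gam" using assms by (simp add: field_simps) linarith
      hence "eventually (\<lambda>u. u < (of_int \<lfloor>gam * t\<rfloor> + 1) / gam) (at_right t)"
        by (intro order_tendstoD[OF tendsto_ident_at])
      thus "eventually (\<lambda>u. ?x u = ?x t) (at_right t)" using eventually_at_right_less[of t]
      proof eventually_elim
        case (elim u)
        have "gam * t \<le> gam * u" using elim assms by simp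
        moreover have "gam * u < of_int \<lfloor>gam * t\<rfloor> + 1" using elim assms by (simp add: field_simps)
        ultimately have "\<lfloor>gam * u\<rfloor> = \<lfloor>gam * t\<rfloor>" by linarith
        thus ?case using t elim by (intro const) auto
      qed
    qed
    show "\<exists>l. (?x \<longlongrightarrow> l) (at_left t)" if t: "t > 0"
    proof -
      \<comment> \<open>The ceiling minus one, not the floor: when gam * t is an integer, the index
        just to the left of t is gam * t - 1.\<close>
      define n where "n = \<lceil>gam * t\<rceil> - 1"
      have n: "of_int n < gam * t" "gam * t \<le> of_int n + 1" unfolding n_def by linarith+
      have n0: "n \<ge> 0" unfolding n_def using assms t by (simp add: )
      have "of_int n / gam < t" using n(1) assms by (simp add: field_simps)
      hence "eventually (\<lambda>u. u \<in> {of_int n / gam<..<t}) (at_left t)"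
        by (rule eventually_at_left_real)
      hence "eventually (\<lambda>u. ?x u = real (z (nat n)) / real k) (at_left t)"
      proof eventually_elim
        case (elim u)
        have "0 \<le> of_int n / gam" using n0 assms by simp
        hence u0: "u \<ge> 0" using elim by auto
        have "of_int n < gam * u" using elim assms by (simp add: field_simps)
        moreover have "gam * u < gam * t" using elim assms by simp
        hence "gam * u < of_int n + 1" using n(2) by linarith
        ultimately have "\<lfloor>gam * u\<rfloor> = n" by linarith
        thus ?case using u0 by (simp add: Ypath_def)
      qed
      thus ?thesis using tendsto_eventually by blast
    qed
  qed
qed

text \<open>Translates oscillation of \<open>exp (- X)\<close> back into oscillation of X below the
  level a. The factor \<open>exp a\<close> dictates the reset threshold \<open>eta\<close> later
  on.\<close>

lemma abs_diff_le_exp_neg: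
  fixes u v a :: real
  assumes "u \<le> a" "v \<le> a"
  shows "\<bar>u - v\<bar> \<le> exp a * \<bar>exp (- u) - exp (- v)\<bar>"
proof -
  have main: "v - u \<le> exp a * (exp (- u) - exp (- v))" if "u \<le> v" "v \<le> a" for u v
  proof -
    have "v - u \<le> exp (v - u) - 1" using exp_ge_add_one_self[of "v - u"] by linarith
    also have "\<dots> = exp v * (exp (- u) - exp (- v))"
      by (simp add: right_diff_distrib exp_add[symmetric])
    also have "\<dots> \<le> exp a * (exp (- u) - exp (- v))" using that by (intro mult_right_mono) auto
    finally show ?thesis .
  qed
  have nn: "u \<le> v \<Longrightarrow> exp (- u) - exp (- v) \<ge> 0" for u v :: real by simp
  show ?thesis
    using main[of u v] main[of v u] nn[of u v] nn[of v u] assms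
    by (cases "u \<le> v") (auto simp: abs_if)
qed

text \<open>Components: current population, population at the last reset, number of steps since then,
  whether two resets ever were at most \<open>d\<close> steps apart, whether \<open>Z / k\<close> ever exceeded \<open>a\<close>.\<close>

type_synonym state = "nat \<times> nat \<times> nat \<times> bool \<times> bool"

definition start :: "nat \<Rightarrow> real \<Rightarrow> nat \<Rightarrow> state" where
  "start k a z = (z, z, 0, False, a < real z / real k)"

text \<open>A reset at this step comes \<open>Suc age\<close> steps after the previous one, hence
  the comparison of \<open>Suc age\<close> with \<open>d\<close>. Time 0 counts as a reset, so the
  first block has to be long as well. Both flags are permanent once raised.\<close>

definition step :: "nat \<Rightarrow> real \<Rightarrow> real \<Rightarrow> nat \<Rightarrow> state \<Rightarrow> nat \<Rightarrow> state" where
  "step k a eta d = (\<lambda>(z, ref, age, bad, ex) w.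
     if \<bar>exp (- (real w / real k)) - exp (- (real ref / real k))\<bar> \<ge> eta
     then (w, w, 0, bad \<or> Suc age \<le> d, ex \<or> a < real w / real k)
     else (w, ref, Suc age, bad, ex \<or> a < real w / real k))"

primrec track :: "nat \<Rightarrow> real \<Rightarrow> real \<Rightarrow> nat \<Rightarrow> (nat \<Rightarrow> nat) \<Rightarrow> nat \<Rightarrow> state" where
  "track k a eta d z 0 = start k a (z 0)"
| "track k a eta d z (Suc n) = step k a eta d (track k a eta d z n) (z (Suc n))"

text \<open>Here \<tau> lists the reset times. The last block is stated separately: it is cut off at
  \<open>N\<close> and may be shorter than the others.\<close>

lemma track_blocks:
  assumes "track k a eta d z N = (w, ref, age, False, False)" "eta > 0"
  defines "u \<equiv> \<lambda>n. exp (- (real (z n) / real k))"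
  shows "(\<forall>n\<le>N. real (z n) / real k \<le> a) \<and> (\<exists>I \<tau>. \<tau> 0 = 0 \<and> (\<forall>i<I. \<tau> i + d < \<tau> (Suc i)) \<and> \<tau> I + age = N
     \<and> ref = z (\<tau> I) \<and> (\<forall>i<I. \<forall>n. \<tau> i \<le> n \<longrightarrow> n < \<tau> (Suc i) \<longrightarrow> \<bar>u n - u (\<tau> i)\<bar> < eta)
     \<and> (\<forall>n. \<tau> I \<le> n \<longrightarrow> n \<le> N \<longrightarrow> \<bar>u n - u (\<tau> I)\<bar> < eta))"
  using assms(1)
proof (induction N arbitrary: w ref age)
  case 0
  thus ?case using assms(2) by (auto simp: start_def u_def intro!: exI[of _ 0] exI[of _ "\<lambda>_. 0"])
next
  case (Suc N)
  obtain w' ref' age' bad' ex' where tr: "track k a eta d z N = (w', ref', age', bad', ex')"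
    by (cases "track k a eta d z N")
  from Suc.prems tr have flags: "\<not> bad'" "\<not> ex'" "real (z (Suc N)) / real k \<le> a"
    by (auto simp: step_def split: if_splits)
  have IH: "\<forall>n\<le>N. real (z n) / real k \<le> a" using Suc.IH tr flags by auto
  obtain I \<tau> where \<tau>: "\<tau> 0 = 0" "\<And>i. i < I \<Longrightarrow> \<tau> i + d < \<tau> (Suc i)" "\<tau> I + age' = N" "ref' = z (\<tau> I)"
    "\<And>i n. i < I \<Longrightarrow> \<tau> i \<le> n \<Longrightarrow> n < \<tau> (Suc i) \<Longrightarrow> \<bar>u n - u (\<tau> i)\<bar> < eta"
    "\<And>n. \<tau> I \<le> n \<Longrightarrow> n \<le> N \<Longrightarrow> \<bar>u n - u (\<tau> I)\<bar> < eta"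
    using Suc.IH[of w' ref' age'] tr flags by metis
  have bound: "\<forall>n\<le>Suc N. real (z n) / real k \<le> a" using IH flags(3) le_Suc_eq by auto
  show ?case
  proof (cases "\<bar>u (Suc N) - u (\<tau> I)\<bar> \<ge> eta")
    case True
    hence st: "ref = z (Suc N)" "age = 0" "\<not> Suc age' \<le> d"
      using Suc.prems tr \<tau>(4) by (auto simp: step_def u_def)
    show ?thesis
    proof (rule conjI[OF bound], rule exI[of _ "Suc I"], rule exI[of _ "\<tau>(Suc I := Suc N)"],
        intro conjI allI impI)
      fix i assume i: "i < Suc I"
      show "(\<tau>(Suc I := Suc N)) i + d < (\<tau>(Suc I := Suc N)) (Suc i)"
        using i \<tau>(2)[of i] \<tau>(3) st(3) by (cases "i = I") auto
      fix n assume "(\<tau>(Suc I := Suc N)) i \<le> n" "n < (\<tau>(Suc I := Suc N)) (Suc i)"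
      thus "\<bar>u n - u ((\<tau>(Suc I := Suc N)) i)\<bar> < eta"
        using i \<tau>(5)[of i n] \<tau>(6)[of n] by (cases "i = I") auto
    next
      fix n assume "(\<tau>(Suc I := Suc N)) (Suc I) \<le> n" "n \<le> Suc N"
      thus "\<bar>u n - u ((\<tau>(Suc I := Suc N)) (Suc I))\<bar> < eta" using assms(2) by auto
    qed (use \<tau>(1) st in auto)
  next
    case False
    hence st: "ref = ref'" "age = Suc age'"
      using Suc.prems tr \<tau>(4) by (auto simp: step_def u_def)
    have "\<bar>u n - u (\<tau> I)\<bar> < eta" if "\<tau> I \<le> n" "n \<le> Suc N" for n
      using that False \<tau>(6)[of n] by (cases "n = Suc N") auto
    thus ?thesis using \<tau> st bound by (intro conjI[OF bound] exI[of _ I] exI[of _ \<tau>]) auto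
  qed
qed

lemma track_block_approx:
  assumes tr: "track k a eta d z (nat \<lfloor>gam * H\<rfloor>) = (w, ref, age, False, False)"
    and eta: "eta > 0" "exp a * eta \<le> e" and gam: "gam > 0" and H: "H \<ge> 0" and del: "del > 0"
    and d: "del * gam \<le> real (Suc d)"
  shows "\<exists>t y. block_approx H del e a (Ypath z gam k) t y"
proof -
  define N where "N = nat \<lfloor>gam * H\<rfloor>"
  define u where "u n = exp (- (real (z n) / real k))" for n
  from track_blocks[OF tr eta(1)] obtain I \<tau> where
    bound: "\<And>n. n \<le> N \<Longrightarrow> real (z n) / real k \<le> a" and
    \<tau>: "\<tau> 0 = 0" "\<And>i. i < I \<Longrightarrow> \<tau> i + d < \<tau> (Suc i)" "\<tau> I + age = N"
    "\<And>i n. i < I \<Longrightarrow> \<tau> i \<le> n \<Longrightarrow> n < \<tau> (Suc i) \<Longrightarrow> \<bar>u n - u (\<tau> i)\<bar> < eta"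
    "\<And>n. \<tau> I \<le> n \<Longrightarrow> n \<le> N \<Longrightarrow> \<bar>u n - u (\<tau> I)\<bar> < eta"
    unfolding u_def N_def by metis
  have a0: "a \<ge> 0" using bound[of 0] by (meson divide_nonneg_nonneg le0 of_nat_0_le_iff order_trans)
  have \<tau>_mono: "\<tau> i \<le> \<tau> I" if "i \<le> I" for i
    using that by (induction rule: inc_induct) (use \<tau>(2) in force)+
  have \<tau>N: "\<tau> i \<le> N" if "i \<le> I" for i using \<tau>_mono[OF that] \<tau>(3) by linarith
  have N: "real N \<le> gam * H" unfolding N_def using gam H by simp
  have \<tau>H: "real (\<tau> i) / gam \<le> H" if "i \<le> I" for i
  proof -
    have "real (\<tau> i) \<le> H * gam" using \<tau>N[OF that] N by (simp add: mult.commute)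
    thus ?thesis using gam by (simp add: divide_le_eq)
  qed
  \<comment> \<open>The filler points start beyond \<open>H\<close>, so the last genuine block is
    extended past the horizon and its possible shortness does no harm. Values are compared with
    centres only before \<open>H\<close>.\<close>
  define t where "t i = (if i \<le> I then real (\<tau> i) / gam else H + real i * del)" for i
  define y where "y i = (if i \<le> I then real (z (\<tau> i)) / real k else 0)" for i
  have close: "\<bar>real (z n) / real k - real (z m) / real k\<bar> \<le> e"
    if "n \<le> N" "m \<le> N" "\<bar>u n - u m\<bar> < eta" for n m
  proof -
    have "\<bar>real (z n) / real k - real (z m) / real k\<bar> \<le> exp a * \<bar>u n - u m\<bar>"
      unfolding u_def using bound that by (intro abs_diff_le_exp_neg) auto
    also have "\<dots> \<le> exp a * eta" using that by simp
    finally show ?thesis using eta(2) by simp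
  qed
  have "block_approx H del e a (Ypath z gam k) t y"
    unfolding block_approx_def
  proof (intro conjI allI impI)
    show "t 0 = 0" by (simp add: t_def \<tau>)
    fix i
    show "t i + del \<le> t (Suc i)"
    proof -
      consider "i < I" | "i = I" | "i > I" by linarith
      thus ?thesis
      proof cases
        case 1
        have "real (\<tau> i) + del * gam \<le> real (\<tau> (Suc i))" using \<tau>(2)[OF 1] d by linarith
        hence "(real (\<tau> i) + del * gam) / gam \<le> real (\<tau> (Suc i)) / gam"
          using gam by (simp add: divide_right_mono)
        thus ?thesis using 1 gam by (simp add: t_def add_divide_distrib)
      next
        case 2
        have "0 \<le> real I * del" using del by simp
        thus ?thesis using \<tau>H[of I] 2 by (simp add: t_def algebra_simps)
      qed (simp add: t_def algebra_simps)
    qed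
    show "t i \<le> H + real i * del" using \<tau>H[of i] del by (auto simp: t_def intro: add_increasing2)
    show "0 \<le> y i" by (simp add: y_def)
    show "y i \<le> a" using bound \<tau>N a0 by (simp add: y_def)
  next
    fix i s assume s: "t i \<le> s" "s < t (Suc i)" "s < H"
    have iI: "i \<le> I"
    proof (rule ccontr)
      assume "\<not> i \<le> I"
      hence "H \<le> t i" using del by (simp add: t_def)
      thus False using s by linarith
    qed
    have s0: "s \<ge> 0" using s(1) iI gam by (auto simp: t_def intro: order_trans[rotated])
    define n where "n = nat \<lfloor>gam * s\<rfloor>"
    have gs0: "gam * s \<ge> 0" using gam s0 by simp
    have n: "real n \<le> gam * s" "gam * s < real n + 1" unfolding n_def using gs0 by linarith+
    have "gam * s \<le> gam * H" using s gam by simp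
    hence nN: "n \<le> N" unfolding n_def N_def by (intro nat_mono floor_mono)
    have "real (\<tau> i) \<le> gam * s" using s(1) iI gam by (simp add: t_def field_simps)
    hence in1: "\<tau> i \<le> n" using n by linarith
    have "\<bar>u n - u (\<tau> i)\<bar> < eta"
    proof (cases "i = I")
      case True thus ?thesis using \<tau>(5) in1 nN by auto
    next
      case False
      hence "gam * s < real (\<tau> (Suc i))" using s(2) iI gam by (simp add: t_def field_simps)
      hence "n < \<tau> (Suc i)" using n by linarith
      thus ?thesis using \<tau>(4)[of i n] False iI in1 by auto
    qed
    hence "\<bar>real (z n) / real k - real (z (\<tau> i)) / real k\<bar> \<le> e"
      using nN \<tau>N[OF iI] by (intro close) auto
    thus "\<bar>Ypath z gam k s - y i\<bar> \<le> e" using iI s0 by (simp add: Ypath_def y_def n_def)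
  qed
  thus ?thesis by blast
qed

section \<open>Probability generating functions\<close>

text \<open>Conditioning on a countable-valued variable, written as a sum over its values. It
  replaces conditional expectations both in the Markov property and for sums with a random number of
  terms.\<close>

lemma nn_integral_countable_split:
  fixes X :: "'a \<Rightarrow> 's::countable"
  assumes X[measurable]: "X \<in> measurable M (count_space UNIV)"
    and F: "\<And>s. F s \<in> borel_measurable M"
  shows "(\<integral>\<^sup>+w. F (X w) w \<partial>M) = (\<integral>\<^sup>+s. (\<integral>\<^sup>+w. F s w * indicator {w. X w = s} w \<partial>M) \<partial>count_space UNIV)"
proof -
  have "(\<integral>\<^sup>+s. (\<integral>\<^sup>+w. F s w * indicator {w. X w = s} w \<partial>M) \<partial>count_space UNIV)
      = (\<integral>\<^sup>+w. (\<integral>\<^sup>+s. F s w * indicator {w. X w = s} w \<partial>count_space UNIV) \<partial>M)"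
  proof (rule nn_integral_count_space_nn_integral[symmetric])
    fix s
    have "(indicator {w. X w = s} :: 'a \<Rightarrow> ennreal) \<in> borel_measurable M"
    proof -
      have "indicator {w. X w = s} = (\<lambda>w. indicator {s} (X w) :: ennreal)" by (auto simp: indicator_def)
      thus ?thesis by simp
    qed
    thus "(\<lambda>w. F s w * indicator {w. X w = s} w) \<in> borel_measurable M" using F by measurable
  qed simp
  also have "(\<lambda>w. \<integral>\<^sup>+s. F s w * indicator {w. X w = s} w \<partial>count_space UNIV) = (\<lambda>w. F (X w) w)"
  proof
    fix w
    have "(\<integral>\<^sup>+s. F s w * indicator {w. X w = s} w \<partial>count_space UNIV)
        = (\<integral>\<^sup>+s. F s w * indicator {X w} s \<partial>count_space UNIV)"
      by (intro nn_integral_cong) (auto simp: indicator_def)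
    also have "\<dots> = F (X w) w" by (simp add: nn_integral_indicator_singleton)
    finally show "(\<integral>\<^sup>+s. F s w * indicator {w. X w = s} w \<partial>count_space UNIV) = F (X w) w" .
  qed
  finally show ?thesis by simp
qed

context prob_space
begin

lemma integrable_power_nat:
  fixes s :: real
  assumes [measurable]: "X \<in> measurable M (count_space (UNIV :: nat set))" and s: "s \<in> {0..1}"
  shows "integrable M (\<lambda>w. s ^ X w)"
  by (rule integrable_const_bound[where B = 1]) (use s in \<open>auto simp: power_le_one\<close>)

text \<open>The power series form, through which the generating function is differentiated inside
  the unit interval.\<close>

lemma pgf_sums:
  fixes s :: real
  assumes X[measurable]: "X \<in> measurable M (count_space (UNIV :: nat set))" and s: "s \<in> {0..1}"
  shows "(\<lambda>n. prob {w \<in> space M. X w = n} * s ^ n) sums expectation (\<lambda>w. s ^ X w)"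
proof -
  define p where "p n = prob {w \<in> space M. X w = n}" for n
  have pos: "0 \<le> p n * s ^ n" for n using s by (simp add: p_def)
  have "ennreal (expectation (\<lambda>w. s ^ X w)) = (\<integral>\<^sup>+w. ennreal (s ^ X w) \<partial>M)"
    using integrable_power_nat[OF X s] s by (intro nn_integral_eq_integral[symmetric]) auto
  also have "\<dots> = (\<integral>\<^sup>+n. (\<integral>\<^sup>+w. ennreal (s ^ n) * indicator {w. X w = n} w \<partial>M) \<partial>count_space UNIV)"
    by (rule nn_integral_countable_split[OF X]) auto
  also have "\<dots> = (\<integral>\<^sup>+n. ennreal (p n * s ^ n) \<partial>count_space UNIV)"
  proof (rule nn_integral_cong)
    fix n :: nat
    have "(\<integral>\<^sup>+w. ennreal (s ^ n) * indicator {w. X w = n} w \<partial>M)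
        = (\<integral>\<^sup>+w. ennreal (s ^ n) * indicator {w \<in> space M. X w = n} w \<partial>M)"
      by (intro nn_integral_cong) (auto simp: indicator_def)
    also have "\<dots> = ennreal (s ^ n) * emeasure M {w \<in> space M. X w = n}"
      by (rule nn_integral_cmult_indicator) measurable
    also have "\<dots> = ennreal (p n * s ^ n)" using s
      by (simp add: p_def emeasure_eq_measure ennreal_mult' mult.commute)
    finally show "(\<integral>\<^sup>+w. ennreal (s ^ n) * indicator {w. X w = n} w \<partial>M) = ennreal (p n * s ^ n)" .
  qed
  also have "\<dots> = (\<Sum>n. ennreal (p n * s ^ n))" by (rule nn_integral_count_space_nat)
  finally have eq: "(\<Sum>n. ennreal (p n * s ^ n)) = ennreal (expectation (\<lambda>w. s ^ X w))" ..
  hence sm: "summable (\<lambda>n. p n * s ^ n)" using pos by (intro summable_suminf_not_top) auto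
  have "ennreal (\<Sum>n. p n * s ^ n) = ennreal (expectation (\<lambda>w. s ^ X w))"
    using suminf_ennreal2[OF pos sm] eq by simp
  moreover have "expectation (\<lambda>w. s ^ X w) \<ge> 0" using s by (intro Bochner_Integration.integral_nonneg) auto
  moreover have "(\<Sum>n. p n * s ^ n) \<ge> 0" by (intro suminf_nonneg sm pos)
  ultimately have "(\<Sum>n. p n * s ^ n) = expectation (\<lambda>w. s ^ X w)" by simp
  thus ?thesis using summable_sums[OF sm] unfolding p_def by simp
qed

lemma pgf_differentiable:
  fixes s :: real
  assumes X: "X \<in> measurable M (count_space (UNIV :: nat set))" and s: "0 < s" "s < 1"
    and h: "\<And>s. s \<in> {0..1} \<Longrightarrow> expectation (\<lambda>w. s ^ X w) = h s"
  shows "h field_differentiable (at s)"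
proof -
  define p where "p n = prob {w \<in> space M. X w = n}" for n
  have sums: "(\<lambda>n. p n * s ^ n) sums h s" if "s \<in> {0..1}" for s
    using pgf_sums[OF X that] h[OF that] by (simp add: p_def)
  have "summable (\<lambda>n. p n * 1 ^ n)" using sums[of 1] by (auto simp: summable_def)
  hence "DERIV (\<lambda>x. \<Sum>n. p n * x ^ n) s :> (\<Sum>n. diffs p n * s ^ n)"
    using s by (intro termdiffs_strong[of p 1]) auto
  hence "DERIV h s :> (\<Sum>n. diffs p n * s ^ n)"
    by (rule has_field_derivative_transform_within_open[where S = "{0<..<1}"])
       (use s sums in \<open>auto simp: sums_iff\<close>)
  thus ?thesis by (auto simp: field_differentiable_def)
qed

text \<open>Termwise differentiation reaches only the open interval. Continuity up to the endpoint 1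
  makes the mean value theorem applicable there.\<close>

lemma pgf_continuous_at_1:
  assumes X[measurable]: "X \<in> measurable M (count_space (UNIV :: nat set))"
    and h: "\<And>s::real. s \<in> {0..1} \<Longrightarrow> expectation (\<lambda>w. s ^ X w) = h s"
  shows "continuous_on {0..1} h"
  unfolding continuous_on_sequentially
proof (intro allI impI ballI, elim conjE)
  fix u :: "nat \<Rightarrow> real" and a assume u: "\<forall>n. u n \<in> {0..1}" "u \<longlonglongrightarrow> a" and a: "a \<in> {0..1}"
  have "(\<lambda>n. expectation (\<lambda>w. u n ^ X w)) \<longlonglongrightarrow> expectation (\<lambda>w. a ^ X w)"
    by (rule integral_dominated_convergence[where w = "\<lambda>_. 1"])
       (use u a in \<open>auto intro!: tendsto_intros simp: power_le_one\<close>)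
  thus "(h \<circ> u) \<longlonglongrightarrow> h a" using h u(1) a by (simp add: o_def)
qed

lemma power_diff_quotient:
  fixes s :: real
  assumes "s < 1"
  shows "(1 - s ^ n) / (1 - s) = (\<Sum>i<n. s ^ i)"
  using assms by (simp add: sum_gp_strict)

text \<open>Convexity in chord form: the chord slope is the mean of the geometric sum of s ^ i over
  i < X, and each term increases with s.\<close>

lemma pgf_quotient_mono:
  fixes s s' :: real
  assumes X[measurable]: "X \<in> measurable M (count_space (UNIV :: nat set))"
    and s: "0 \<le> s" "s \<le> s'" "s' < 1"
  shows "(1 - expectation (\<lambda>w. s ^ X w)) / (1 - s) \<le> (1 - expectation (\<lambda>w. s' ^ X w)) / (1 - s')"
proof -
  have I: "integrable M (\<lambda>w. s ^ X w)" "integrable M (\<lambda>w. s' ^ X w)"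
    using s by (auto intro!: integrable_power_nat[OF X])
  have eq: "expectation (\<lambda>w. (1 - t ^ X w) / (1 - t)) = (1 - expectation (\<lambda>w. t ^ X w)) / (1 - t)"
    if "integrable M (\<lambda>w. t ^ X w)" for t :: real
    using that by (simp add: prob_space)
  have "expectation (\<lambda>w. (1 - s ^ X w) / (1 - s)) \<le> expectation (\<lambda>w. (1 - s' ^ X w) / (1 - s'))"
  proof (rule integral_mono)
    fix w
    show "(1 - s ^ X w) / (1 - s) \<le> (1 - s' ^ X w) / (1 - s')"
      using s by (simp add: power_diff_quotient sum_mono power_mono)
  qed (use I in auto)
  thus ?thesis unfolding eq[OF I(1)] eq[OF I(2)] .
qed

text \<open>Condition (C) provides the derivative at 1 only as a left limit of \<open>deriv\<close>.
  The mean value theorem bounds chord slopes close to 1 by D + e, and monotonicity of these slopes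
  extends the bound to every s.\<close>

lemma pgf_le_deriv_at_1:
  fixes s D :: real
  assumes X: "X \<in> measurable M (count_space (UNIV :: nat set))"
    and h: "\<And>s. s \<in> {0..1} \<Longrightarrow> expectation (\<lambda>w. s ^ X w) = h s"
    and D: "(deriv h \<longlongrightarrow> D) (at_left 1)" and s: "s \<in> {0..1}"
  shows "1 - h s \<le> D * (1 - s)"
proof (cases "s = 1")
  case True thus ?thesis using h[of 1] by (simp add: prob_space)
next
  case False
  hence s1: "0 \<le> s" "s < 1" using s by auto
  have h1: "h 1 = 1" using h[of 1] by (simp add: prob_space)
  have "(1 - h s) / (1 - s) \<le> D + e" if e: "e > 0" for e
  proof -
    have "eventually (\<lambda>x. deriv h x < D + e) (at_left 1)" using e by (intro order_tendstoD[OF D]) auto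
    then obtain b where b: "b < 1" "\<And>x. b < x \<Longrightarrow> x < 1 \<Longrightarrow> deriv h x < D + e"
      using eventually_at_left[of "0::real" 1 "\<lambda>x. deriv h x < D + e"] by auto
    \<comment> \<open>The value 1/2 only keeps s' strictly positive, where differentiability is
      available.\<close>
    define s' where "s' = max s (max b (1/2))"
    have s': "s \<le> s'" "b \<le> s'" "0 < s'" "s' < 1" using s1 b by (auto simp: s'_def)
    have "\<exists>l z. z > s' \<and> z < 1 \<and> DERIV h z :> l \<and> h 1 - h s' = (1 - s') * l"
    proof (rule MVT)
      show "continuous_on {s'..1} h"
        by (rule continuous_on_subset[OF pgf_continuous_at_1[OF X h]]) (use s' in auto)
      fix x assume "s' < x" "x < 1"
      thus "h differentiable at x"
        using pgf_differentiable[OF X _ _ h, of x] s'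
        by (simp add: field_differentiable_imp_differentiable)
    qed (use s' in auto)
    then obtain l z where z: "z > s'" "z < 1" "DERIV h z :> l" "h 1 - h s' = (1 - s') * l" by blast
    have "l = deriv h z" using z(3) by (simp add: DERIV_imp_deriv)
    hence "l < D + e" using b(2)[of z] z s' by auto
    moreover have "(1 - h s') / (1 - s') = l" using z(4) h1 s' by simp
    moreover have "(1 - h s) / (1 - s) \<le> (1 - h s') / (1 - s')"
      using pgf_quotient_mono[OF X, of s s'] h[of s] h[of s'] s' s by auto
    ultimately show ?thesis by linarith
  qed
  hence "(1 - h s) / (1 - s) \<le> D" by (rule field_le_epsilon)
  thus ?thesis using s1 by (simp add: divide_le_eq)
qed

text \<open>The chord slopes (1 - u ^ X) / (1 - u) tend to X as u increases to 1, so Fatou's lemma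
  turns a bound on slopes into a bound on the mean. Arguments near 1 suffice; this matters because
  the offspring generating function is controlled only within 2 / k of 1.\<close>

lemma mean_le_of_pgf:
  fixes c s0 :: real
  assumes X[measurable]: "X \<in> measurable M (count_space (UNIV :: nat set))"
    and c: "\<And>s. s0 \<le> s \<Longrightarrow> 0 \<le> s \<Longrightarrow> s < 1 \<Longrightarrow> 1 - expectation (\<lambda>w. s ^ X w) \<le> c * (1 - s)"
    and s0: "s0 < 1"
  shows "(\<integral>\<^sup>+w. ennreal (real (X w)) \<partial>M) \<le> ennreal c"
proof -
  obtain u :: "nat \<Rightarrow> real" where u: "\<And>n. max 0 s0 < u n" "\<And>n. u n < 1" "u \<longlonglongrightarrow> 1"
  proof -
    define m where "m = max 0 s0"
    have m: "0 \<le> m" "m < 1" using s0 by (auto simp: m_def)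
    define u where "u n = 1 - (1 - m) / 2 * inverse (real (Suc n))" for n
    have "u \<longlonglongrightarrow> 1 - (1 - m) / 2 * 0" unfolding u_def
      by (intro tendsto_intros LIMSEQ_inverse_real_of_nat)
    moreover have "m < u n" for n
    proof -
      have "inverse (real (Suc n)) \<le> 1" by (simp add: inverse_le_1_iff)
      hence "(1 - m) / 2 * inverse (real (Suc n)) \<le> (1 - m) / 2 * 1"
        using m by (intro mult_left_mono) auto
      also have "\<dots> < 1 - m" using m by simp
      finally show ?thesis unfolding u_def by linarith
    qed
    moreover have "u n < 1" for n
    proof -
      have "0 < (1 - m) / 2 * inverse (real (Suc n))" using m by (intro mult_pos_pos) auto
      thus ?thesis unfolding u_def by linarith
    qed
    ultimately show ?thesis using that[of u] unfolding m_def by simp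
  qed
  define f where "f n w = ennreal (\<Sum>i<X w. u n ^ i)" for n w
  have "(\<lambda>n. f n w) \<longlonglongrightarrow> ennreal (real (X w))" for w
  proof -
    have "(\<lambda>n. \<Sum>i<X w. u n ^ i) \<longlonglongrightarrow> (\<Sum>i<X w. 1 ^ i)" by (intro tendsto_intros u)
    thus ?thesis unfolding f_def by (auto intro: tendsto_ennrealI)
  qed
  hence lim: "ennreal (real (X w)) = liminf (\<lambda>n. f n w)" for w
    by (intro lim_imp_Liminf[symmetric]) auto
  have "(\<integral>\<^sup>+w. ennreal (real (X w)) \<partial>M) \<le> liminf (\<lambda>n. \<integral>\<^sup>+w. f n w \<partial>M)"
    unfolding lim by (rule nn_integral_liminf) (simp add: f_def)
  also have "\<dots> \<le> liminf (\<lambda>n. ennreal c)"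
  proof (intro Liminf_mono always_eventually allI)
    fix n
    have I: "integrable M (\<lambda>w. u n ^ X w)" by (rule integrable_power_nat[OF X]) (use u(1,2)[of n] in auto)
    have "(\<integral>\<^sup>+w. f n w \<partial>M) = (\<integral>\<^sup>+w. ennreal ((1 - u n ^ X w) / (1 - u n)) \<partial>M)"
      unfolding f_def using u(2) by (simp add: power_diff_quotient)
    also have "\<dots> = ennreal (expectation (\<lambda>w. (1 - u n ^ X w) / (1 - u n)))"
    proof (rule nn_integral_eq_integral)
      show "AE w in M. 0 \<le> (1 - u n ^ X w) / (1 - u n)"
        using u(1,2)[of n] by (auto intro!: divide_nonneg_pos simp: power_le_one)
    qed (use I in auto)
    also have "expectation (\<lambda>w. (1 - u n ^ X w) / (1 - u n)) = (1 - expectation (\<lambda>w. u n ^ X w)) / (1 - u n)"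
      using I by (simp add: prob_space)
    also have "\<dots> \<le> c" using c[of "u n"] u(1,2)[of n] by (simp add: divide_le_eq)
    finally show "(\<integral>\<^sup>+w. f n w \<partial>M) \<le> ennreal c" by (simp add: ennreal_leI)
  qed
  also have "\<dots> = ennreal c" by (simp add: Liminf_const)
  finally show ?thesis .
qed

end

section \<open>The Markov property\<close>

lemma track_congr: "(\<And>i. i \<le> n \<Longrightarrow> z i = z' i) \<Longrightarrow> track k a eta d z n = track k a eta d z' n"
  by (induction n) auto

lemma fst_track: "fst (track k a eta d z n) = z n"
  by (cases n) (auto simp: start_def step_def split: prod.splits)

lemma measurable_track:
  assumes "\<And>i. i \<le> n \<Longrightarrow> (\<lambda>x. f x i) \<in> measurable N (count_space UNIV)"
  shows "(\<lambda>x. track k a eta d (f x) n) \<in> measurable N (count_space UNIV)"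
  using assms
proof (induction n)
  case 0
  show ?case by (simp, rule measurable_compose[OF 0[of 0]]) auto
next
  case (Suc n)
  have "(\<lambda>x. track k a eta d (f x) n) \<in> measurable N (count_space UNIV)" using Suc by simp
  moreover have "(\<lambda>x. step k a eta d s (f x (Suc n))) \<in> measurable N (count_space UNIV)" for s
    by (rule measurable_compose[OF Suc.prems[of "Suc n"]]) auto
  ultimately show ?case
    unfolding track.simps by (rule measurable_compose_countable[rotated])
qed

lemma (in prob_space) indep_var_nn_integral_mult:
  fixes f :: "_ \<Rightarrow> ennreal"
  assumes "indep_var S X T Y" "f \<in> borel_measurable S" "g \<in> borel_measurable T"
  shows "(\<integral>\<^sup>+w. f (X w) * g (Y w) \<partial>M) = (\<integral>\<^sup>+w. f (X w) \<partial>M) * (\<integral>\<^sup>+w. g (Y w) \<partial>M)"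
proof -
  have "indep_var borel (f \<circ> X) borel (g \<circ> Y)" by (rule indep_var_compose[OF assms])
  hence ind: "indep_vars (\<lambda>_. borel) (case_bool (f \<circ> X) (g \<circ> Y)) UNIV"
    unfolding indep_var_def by (rule back_subst[of "\<lambda>b. indep_vars b _ _"]) (auto split: bool.split)
  have "(\<integral>\<^sup>+w. (\<Prod>b\<in>UNIV. case_bool (f \<circ> X) (g \<circ> Y) b w) \<partial>M)
      = (\<Prod>b\<in>UNIV. \<integral>\<^sup>+w. case_bool (f \<circ> X) (g \<circ> Y) b w \<partial>M)"
    by (rule indep_vars_nn_integral[OF _ ind]) auto
  thus ?thesis by (simp add: UNIV_bool mult.commute o_def)
qed

locale branching = prob_space M for M :: "'a measure" +
  fixes xi :: "nat \<Rightarrow> nat \<Rightarrow> 'a \<Rightarrow> nat" and psi :: "nat \<Rightarrow> 'a \<Rightarrow> nat \<Rightarrow> nat" and Z0 :: "'a \<Rightarrow> nat"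
    and g :: "real \<Rightarrow> real" and h :: "nat \<Rightarrow> real \<Rightarrow> real"
  assumes indep: "indep_vars (\<lambda>_. PiM UNIV (\<lambda>_. count_space UNIV))
          (\<lambda>j w. case j of Inl (n, i) \<Rightarrow> (\<lambda>_. xi n i w)
                           | Inr (Some n) \<Rightarrow> psi n w
                           | Inr None \<Rightarrow> (\<lambda>_. Z0 w)) UNIV"
    and xi_pgf: "\<And>n i s. s \<in> {0..1} \<Longrightarrow> expectation (\<lambda>w. s ^ xi n i w) = g s"
    and psi_pgf: "\<And>n i s. s \<in> {0..1} \<Longrightarrow> expectation (\<lambda>w. s ^ psi n w i) = h i s"
begin

abbreviation "paths \<equiv> (PiM UNIV (\<lambda>_. count_space UNIV) :: (nat \<Rightarrow> nat) measure)"

definition fam :: "(nat \<times> nat) + nat option \<Rightarrow> 'a \<Rightarrow> nat \<Rightarrow> nat" where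
  "fam j w = (case j of Inl (n, i) \<Rightarrow> (\<lambda>_. xi n i w) | Inr (Some n) \<Rightarrow> psi n w | Inr None \<Rightarrow> (\<lambda>_. Z0 w))"

definition Zp :: "'a \<Rightarrow> nat \<Rightarrow> nat" where
  "Zp w = Zproc (\<lambda>n i. xi n i w) (\<lambda>n. psi n w) (Z0 w)"

definition offspring :: "nat \<Rightarrow> nat \<Rightarrow> 'a \<Rightarrow> nat" where
  "offspring n z w = (\<Sum>i\<in>{1..z + psi n w z}. xi n i w)"

text \<open>These are the indices of all randomness that generations up to n depend on;
  \<open>present n\<close> indexes what drives the step from n to n + 1. Splitting the index set
  plays the role of a filtration.\<close>

definition past :: "nat \<Rightarrow> ((nat \<times> nat) + nat option) set" where
  "past n = {j. case j of Inl (m, i) \<Rightarrow> m < n | Inr (Some m) \<Rightarrow> m < n | Inr None \<Rightarrow> True}"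

definition present :: "nat \<Rightarrow> ((nat \<times> nat) + nat option) set" where
  "present n = {j. case j of Inl (m, i) \<Rightarrow> m = n | Inr (Some m) \<Rightarrow> m = n | Inr None \<Rightarrow> False}"

text \<open>\<open>Zp\<close> and \<open>offspring\<close> as functionals of the independent family \<open>fam\<close>.\<close>

definition Zof :: "((nat \<times> nat) + nat option \<Rightarrow> nat \<Rightarrow> nat) \<Rightarrow> nat \<Rightarrow> nat" where
  "Zof r = Zproc (\<lambda>n i. r (Inl (n, i)) 0) (\<lambda>n. r (Inr (Some n))) (r (Inr None) 0)"

definition offspring_of :: "nat \<Rightarrow> nat \<Rightarrow> ((nat \<times> nat) + nat option \<Rightarrow> nat \<Rightarrow> nat) \<Rightarrow> nat" where
  "offspring_of n z r = (\<Sum>i\<in>{1..z + r (Inr (Some n)) z}. r (Inl (n, i)) 0)"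

section \<open>Measurability and dependence on past and present randomness\<close>

lemma fam_indep: "indep_vars (\<lambda>_. paths) fam UNIV"
  using indep by (simp add: fam_def[abs_def])

lemma Zp_Suc: "Zp w (Suc n) = offspring n (Zp w n) w"
  by (simp add: Zp_def offspring_def Let_def)

lemma Zof_Suc: "Zof r (Suc m) = offspring_of m (Zof r m) r"
  by (simp add: Zof_def offspring_of_def Let_def)

lemma measurable_coordinate:
  assumes "j \<in> J"
  shows "(\<lambda>r. r j i) \<in> measurable (PiM J (\<lambda>_. paths)) (count_space UNIV)"
  by (rule measurable_compose[OF measurable_component_singleton[OF assms] measurable_component_singleton]) simp

lemma measurable_Zof: "m \<le> n \<Longrightarrow> (\<lambda>r. Zof r m) \<in> measurable (PiM (past n) (\<lambda>_. paths)) (count_space UNIV)"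
proof (induction m)
  case 0
  show ?case unfolding Zof_def Zproc.simps by (rule measurable_coordinate) (simp add: past_def)
next
  case (Suc m)
  have IH: "(\<lambda>r. Zof r m) \<in> measurable (PiM (past n) (\<lambda>_. paths)) (count_space UNIV)" using Suc by simp
  have c1: "(\<lambda>r. r (Inr (Some m)) z) \<in> measurable (PiM (past n) (\<lambda>_. paths)) (count_space UNIV)" for z
    by (rule measurable_coordinate) (use Suc in \<open>simp add: past_def\<close>)
  have c2: "(\<lambda>r. \<Sum>i\<in>{1..p}. r (Inl (m, i)) 0) \<in> measurable (PiM (past n) (\<lambda>_. paths)) (count_space UNIV)" for p
    by (intro measurable_sum_nat measurable_coordinate) (use Suc in \<open>simp add: past_def\<close>)
  have c3: "(\<lambda>r. offspring_of m z r) \<in> measurable (PiM (past n) (\<lambda>_. paths)) (count_space UNIV)" for z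
    unfolding offspring_of_def
    by (rule measurable_compose_countable[OF c2, where g = "\<lambda>r. z + r (Inr (Some m)) z"])
       (rule measurable_compose[OF c1], simp)
  show ?case
    using measurable_compose_countable[OF c3 IH] by (simp add: Zof_Suc)
qed

lemma measurable_offspring_of:
  "offspring_of n z \<in> measurable (PiM (present n) (\<lambda>_. paths)) (count_space UNIV)"
proof -
  have c1: "(\<lambda>r. r (Inr (Some n)) z) \<in> measurable (PiM (present n) (\<lambda>_. paths)) (count_space UNIV)"
    by (rule measurable_coordinate) (simp add: present_def)
  have c2: "(\<lambda>r. \<Sum>i\<in>{1..p}. r (Inl (n, i)) 0) \<in> measurable (PiM (present n) (\<lambda>_. paths)) (count_space UNIV)" for p
    by (intro measurable_sum_nat measurable_coordinate) (simp add: present_def)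
  show ?thesis unfolding offspring_of_def[abs_def]
    by (rule measurable_compose_countable[OF c2, where g = "\<lambda>r. z + r (Inr (Some n)) z"])
       (rule measurable_compose[OF c1], simp)
qed

lemma Zof_past: "m \<le> n \<Longrightarrow> Zof (restrict (\<lambda>j. fam j w) (past n)) m = Zp w m"
proof (induction m)
  case 0
  show ?case by (simp add: Zof_def Zp_def past_def fam_def)
next
  case (Suc m)
  define r where "r = restrict (\<lambda>j. fam j w) (past n)"
  have "r (Inl (m, i)) 0 = xi m i w" "r (Inr (Some m)) = psi m w" for i
    using Suc.prems by (simp_all add: r_def past_def fam_def)
  moreover have "Zof r m = Zp w m" unfolding r_def by (rule Suc.IH) (use Suc.prems in simp)
  ultimately show ?case unfolding r_def[symmetric]
    by (simp add: Zof_Suc Zp_Suc offspring_of_def offspring_def)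
qed

lemma offspring_of_present: "offspring_of n z (restrict (\<lambda>j. fam j w) (present n)) = offspring n z w"
  by (simp add: offspring_of_def offspring_def present_def fam_def)

lemma random_variable_fam: "fam j \<in> measurable M paths"
  using fam_indep by (auto simp: indep_vars_def)

lemma random_variable_restrict:
  "(\<lambda>w. restrict (\<lambda>j. fam j w) J) \<in> measurable M (PiM J (\<lambda>_. paths))"
  by (rule measurable_restrict) (rule random_variable_fam)

lemma measurable_Zp[measurable]: "(\<lambda>w. Zp w n) \<in> measurable M (count_space UNIV)"
  using measurable_compose[OF random_variable_restrict[of "past n"] measurable_Zof[of n n]]
  by (simp add: Zof_past)

lemma measurable_offspring[measurable]: "offspring n z \<in> measurable M (count_space UNIV)"
  using measurable_compose[OF random_variable_restrict[of "present n"] measurable_offspring_of[of n z]]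
  by (simp add: offspring_of_present)

lemma measurable_track_Zp[measurable]:
  "(\<lambda>w. track k a eta d (Zp w) n) \<in> measurable M (count_space UNIV)"
  by (rule measurable_track) measurable

lemma measurable_fam_components[measurable]:
  "xi n i \<in> measurable M (count_space UNIV)" "(\<lambda>w. psi n w i) \<in> measurable M (count_space UNIV)"
proof -
  have "(\<lambda>w. fam j w i) \<in> measurable M (count_space UNIV)" for j i
    by (rule measurable_compose[OF random_variable_fam measurable_component_singleton]) simp
  from this[of "Inl (n, i)" 0] this[of "Inr (Some n)" i] show
    "xi n i \<in> measurable M (count_space UNIV)" "(\<lambda>w. psi n w i) \<in> measurable M (count_space UNIV)"
    by (simp_all add: fam_def)
qed

lemma past_present_disjoint: "present n \<inter> past n = {}"
proof (rule equals0I)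
  fix j assume j: "j \<in> present n \<inter> past n"
  consider m i where "j = Inl (m, i)" | m where "j = Inr (Some m)" | "j = Inr None"
    by (metis sum.exhaust option.exhaust surj_pair)
  thus False using j by cases (auto simp: past_def present_def)
qed

text \<open>The Markov property in the form needed. The population size \<open>z\<close> is frozen
  to a constant, so \<open>offspring n z\<close> depends on present randomness alone, while the
  tracked state depends on the past alone.\<close>

lemma past_present_independent:
  fixes f :: "nat \<Rightarrow> ennreal"
  shows "(\<integral>\<^sup>+w. f (offspring n z w) * indicator {w. track k a eta d (Zp w) n = s} w \<partial>M)
     = (\<integral>\<^sup>+w. f (offspring n z w) \<partial>M) * (\<integral>\<^sup>+w. indicator {w. track k a eta d (Zp w) n = s} w \<partial>M)"
proof -
  define F where "F r = (indicator {s} (track k a eta d (Zof r) n) :: ennreal)" for r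
  have "(\<lambda>r. track k a eta d (Zof r) n) \<in> measurable (PiM (past n) (\<lambda>_. paths)) (count_space UNIV)"
    by (rule measurable_track) (rule measurable_Zof)
  hence F: "F \<in> borel_measurable (PiM (past n) (\<lambda>_. paths))"
    unfolding F_def by (rule measurable_compose) simp
  have f: "(\<lambda>r. f (offspring_of n z r)) \<in> borel_measurable (PiM (present n) (\<lambda>_. paths))"
    by (rule measurable_compose[OF measurable_offspring_of]) simp
  have "indep_var (PiM (present n) (\<lambda>_. paths)) (\<lambda>w. restrict (\<lambda>j. fam j w) (present n))
       (PiM (past n) (\<lambda>_. paths)) (\<lambda>w. restrict (\<lambda>j. fam j w) (past n))"
    by (rule indep_var_restrict[OF fam_indep past_present_disjoint]) auto
  from indep_var_nn_integral_mult[OF this f F] 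
  have "(\<integral>\<^sup>+w. f (offspring n z w) * F (restrict (\<lambda>j. fam j w) (past n)) \<partial>M)
     = (\<integral>\<^sup>+w. f (offspring n z w) \<partial>M) * (\<integral>\<^sup>+w. F (restrict (\<lambda>j. fam j w) (past n)) \<partial>M)"
    by (simp add: offspring_of_present)
  moreover have "F (restrict (\<lambda>j. fam j w) (past n)) = indicator {w. track k a eta d (Zp w) n = s} w" for w
    using track_congr[of n "Zof (restrict (\<lambda>j. fam j w) (past n))" "Zp w" k a eta d] Zof_past
    by (simp add: F_def indicator_def)
  ultimately show ?thesis by simp
qed

text \<open>Drift conditions then need checking only for a deterministic state. Unreachable states
  have weight zero, and the restriction to reachable ones is essential for applications: only for
  these does an unraised flag say that the current population is below the level.\<close>

lemma track_drift:
  fixes V :: "state \<Rightarrow> ennreal"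
  assumes drift: "\<And>s. s \<in> range (\<lambda>w. track k a eta d (Zp w) n) \<Longrightarrow>
      (\<integral>\<^sup>+w. V (step k a eta d s (offspring n (fst s) w)) \<partial>M) \<le> \<alpha> * V s + \<beta>"
  shows "(\<integral>\<^sup>+w. V (track k a eta d (Zp w) (Suc n)) \<partial>M)
       \<le> \<alpha> * (\<integral>\<^sup>+w. V (track k a eta d (Zp w) n) \<partial>M) + \<beta>"
proof -
  let ?S = "\<lambda>w. track k a eta d (Zp w) n"
  let ?F = "\<lambda>s w. V (step k a eta d s (offspring n (fst s) w))"
  have S: "?S \<in> measurable M (count_space UNIV)" by measurable
  have F: "?F s \<in> borel_measurable M" for s
    by (rule measurable_compose[OF measurable_offspring]) simp
  have "(\<integral>\<^sup>+w. V (track k a eta d (Zp w) (Suc n)) \<partial>M) = (\<integral>\<^sup>+w. ?F (?S w) w \<partial>M)"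
    by (simp add: Zp_Suc fst_track)
  also have "\<dots> = (\<integral>\<^sup>+s. (\<integral>\<^sup>+w. ?F s w * indicator {w. ?S w = s} w \<partial>M) \<partial>count_space UNIV)"
    by (rule nn_integral_countable_split[OF S F])
  also have "\<dots> = (\<integral>\<^sup>+s. (\<integral>\<^sup>+w. ?F s w \<partial>M) * (\<integral>\<^sup>+w. indicator {w. ?S w = s} w \<partial>M) \<partial>count_space UNIV)"
    using past_present_independent[of "\<lambda>v. V (step k a eta d _ v)"] by simp
  also have "\<dots> \<le> (\<integral>\<^sup>+s. (\<alpha> * V s + \<beta>) * (\<integral>\<^sup>+w. indicator {w. ?S w = s} w \<partial>M) \<partial>count_space UNIV)"
  proof (rule nn_integral_mono)
    fix s
    show "(\<integral>\<^sup>+w. ?F s w \<partial>M) * (\<integral>\<^sup>+w. indicator {w. ?S w = s} w \<partial>M)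
      \<le> (\<alpha> * V s + \<beta>) * (\<integral>\<^sup>+w. indicator {w. ?S w = s} w \<partial>M)"
    proof (cases "s \<in> range ?S")
      case True thus ?thesis by (intro mult_right_mono drift) auto
    next
      case False
      hence "{w. ?S w = s} = {}" by auto
      thus ?thesis by simp
    qed
  qed
  also have "\<dots> = (\<integral>\<^sup>+s. (\<integral>\<^sup>+w. (\<alpha> * V s + \<beta>) * indicator {w. ?S w = s} w \<partial>M) \<partial>count_space UNIV)"
  proof (rule nn_integral_cong)
    fix s
    have "indicator {w. ?S w = s} = (\<lambda>w. indicator {s} (?S w) :: ennreal)" by (auto simp: indicator_def)
    moreover have "(\<lambda>w. indicator {s} (?S w) :: ennreal) \<in> borel_measurable M"
      by (rule measurable_compose[OF S]) simp
    ultimately show "(\<alpha> * V s + \<beta>) * (\<integral>\<^sup>+w. indicator {w. ?S w = s} w \<partial>M)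
      = (\<integral>\<^sup>+w. (\<alpha> * V s + \<beta>) * indicator {w. ?S w = s} w \<partial>M)"
      by (simp add: nn_integral_cmult)
  qed
  also have "\<dots> = (\<integral>\<^sup>+w. \<alpha> * V (?S w) + \<beta> \<partial>M)"
    by (rule nn_integral_countable_split[OF S, symmetric]) simp
  also have "\<dots> = \<alpha> * (\<integral>\<^sup>+w. V (?S w) \<partial>M) + \<beta>"
  proof -
    have "(\<lambda>w. V (?S w)) \<in> borel_measurable M" by (rule measurable_compose[OF S]) simp
    thus ?thesis by (simp add: nn_integral_add nn_integral_cmult emeasure_space_1)
  qed
  finally show ?thesis .
qed

section \<open>Generating function of one transition\<close>

lemma nn_pgf:
  assumes X: "X \<in> measurable M (count_space (UNIV :: nat set))" and s: "s \<in> {0..1::real}"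
  shows "(\<integral>\<^sup>+w. ennreal (s ^ X w) \<partial>M) = ennreal (expectation (\<lambda>w. s ^ X w))"
  using integrable_power_nat[OF X s] s by (intro nn_integral_eq_integral) auto

lemma pgf_range:
  assumes X: "X \<in> measurable M (count_space (UNIV :: nat set))" and s: "s \<in> {0..1::real}"
  shows "expectation (\<lambda>w. s ^ X w) \<in> {0..1}"
proof -
  have "expectation (\<lambda>w. s ^ X w) \<le> expectation (\<lambda>_. 1)"
    using integrable_power_nat[OF X s] s by (intro integral_mono) (auto simp: power_le_one)
  moreover have "0 \<le> expectation (\<lambda>w. s ^ X w)" using s by (intro Bochner_Integration.integral_nonneg) auto
  ultimately show ?thesis by (simp add: prob_space)
qed

text \<open>Splitting over the value p of the immigration makes the number of children constant; the
  independent factors then recombine into the composition with g.\<close>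

lemma offspring_pgf:
  assumes s: "s \<in> {0..1}"
  shows "expectation (\<lambda>w. s ^ offspring n z w) = g s ^ z * h z (g s)"
proof -
  have gs: "g s \<in> {0..1}" using pgf_range[of "xi 0 0" s] xi_pgf[OF s, of 0 0] s by simp
  have ps: "(\<lambda>w. psi n w z) \<in> measurable M (count_space UNIV)" by measurable
  let ?G = "\<lambda>p w. ennreal (s ^ (\<Sum>i\<in>{1..z + p}. xi n i w))"
  have each: "(\<integral>\<^sup>+w. ?G p w * indicator {w. psi n w z = p} w \<partial>M)
     = (\<integral>\<^sup>+w. ennreal (g s ^ (z + p)) * indicator {w. psi n w z = p} w \<partial>M)" for p
  proof -
    \<comment> \<open>The finitely many sources that matter when the immigration equals p.
      \<open>Y\<close> assigns to each child its power of s, and to the immigration function the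
      indicator of the value p.\<close>
    let ?J = "insert (Inr (Some n)) ((\<lambda>i. Inl (n, i)) ` {1..z + p}) :: ((nat \<times> nat) + nat option) set"
    define Y where "Y j v = (case j of Inl _ \<Rightarrow> ennreal (s ^ v 0) | Inr _ \<Rightarrow> indicator {p} (v z))"
      for j :: "(nat \<times> nat) + nat option" and v :: "nat \<Rightarrow> nat"
    have Ym: "Y j \<in> borel_measurable paths" for j
    proof -
      have "(\<lambda>v. v i) \<in> measurable paths (count_space UNIV)" for i
        by (rule measurable_component_singleton) simp
      from measurable_compose[OF this, of "\<lambda>m. ennreal (s ^ m)" borel 0]
        measurable_compose[OF this, of "\<lambda>m. indicator {p} m" borel z]
      show ?thesis by (cases j) (auto simp: Y_def[abs_def])
    qed
    have "(\<integral>\<^sup>+w. (\<Prod>j\<in>?J. Y j (fam j w)) \<partial>M) = (\<Prod>j\<in>?J. \<integral>\<^sup>+w. Y j (fam j w) \<partial>M)"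
      by (rule indep_vars_nn_integral) 
         (auto intro!: indep_vars_compose2[OF indep_vars_subset[OF fam_indep]] Ym)
    moreover have "(\<Prod>j\<in>?J. Y j (fam j w)) = ?G p w * indicator {w. psi n w z = p} w" for w
      using s by (subst prod.insert) (auto simp: image_iff prod.reindex inj_on_def Y_def fam_def
          indicator_def prod_ennreal power_sum)
    moreover have "(\<Prod>j\<in>?J. \<integral>\<^sup>+w. Y j (fam j w) \<partial>M)
       = ennreal (g s ^ (z + p)) * (\<integral>\<^sup>+w. indicator {w. psi n w z = p} w \<partial>M)"
    proof -
      have "(\<integral>\<^sup>+w. Y (Inl (n, i)) (fam (Inl (n, i)) w) \<partial>M) = ennreal (g s)" for i
        using nn_pgf[of "xi n i" s] xi_pgf[OF s, of n i] s by (simp add: Y_def fam_def)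
      moreover have "(\<integral>\<^sup>+w. Y (Inr (Some n)) (fam (Inr (Some n)) w) \<partial>M)
          = (\<integral>\<^sup>+w. indicator {w. psi n w z = p} w \<partial>M)"
        by (intro nn_integral_cong) (simp add: Y_def fam_def indicator_def)
      ultimately show ?thesis using gs
        by (subst prod.insert) (auto simp: image_iff prod.reindex inj_on_def ennreal_power mult.commute)
    qed
    moreover have "(\<integral>\<^sup>+w. ennreal (g s ^ (z + p)) * indicator {w. psi n w z = p} w \<partial>M)
       = ennreal (g s ^ (z + p)) * (\<integral>\<^sup>+w. indicator {w. psi n w z = p} w \<partial>M)"
    proof -
      have "indicator {w. psi n w z = p} = (\<lambda>w. indicator {p} (psi n w z) :: ennreal)" by (auto simp: indicator_def)
      moreover have "(\<lambda>w. indicator {p} (psi n w z) :: ennreal) \<in> borel_measurable M"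
        by (rule measurable_compose[OF ps]) simp
      ultimately show ?thesis by (simp add: nn_integral_cmult)
    qed
    ultimately show ?thesis by simp
  qed
  have "ennreal (expectation (\<lambda>w. s ^ offspring n z w)) = (\<integral>\<^sup>+w. ennreal (s ^ offspring n z w) \<partial>M)"
    using nn_pgf[OF measurable_offspring s] by simp
  also have "\<dots> = (\<integral>\<^sup>+w. ?G (psi n w z) w \<partial>M)" by (simp add: offspring_def)
  also have "\<dots> = (\<integral>\<^sup>+p. (\<integral>\<^sup>+w. ?G p w * indicator {w. psi n w z = p} w \<partial>M) \<partial>count_space UNIV)"
    by (rule nn_integral_countable_split[OF ps]) measurable
  also have "\<dots> = (\<integral>\<^sup>+w. ennreal (g s ^ (z + psi n w z)) \<partial>M)"
    unfolding each by (rule nn_integral_countable_split[OF ps, symmetric]) measurable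
  also have "\<dots> = (\<integral>\<^sup>+w. ennreal (g s ^ z) * ennreal (g s ^ psi n w z) \<partial>M)"
    using gs by (simp add: power_add ennreal_mult)
  also have "\<dots> = ennreal (g s ^ z) * (\<integral>\<^sup>+w. ennreal (g s ^ psi n w z) \<partial>M)"
    by (rule nn_integral_cmult) measurable
  also have "\<dots> = ennreal (g s ^ z) * ennreal (h z (g s))"
    using nn_pgf[OF ps gs] psi_pgf[OF gs] by simp
  also have "\<dots> = ennreal (g s ^ z * h z (g s))" using gs by (simp add: ennreal_mult')
  finally show ?thesis
    using pgf_range[OF measurable_offspring s, of n z] gs pgf_range[OF ps gs] psi_pgf[OF gs, of n z]
    by (simp add: ennreal_inj)
qed

end

section \<open>Drift estimates\<close>

definition fails :: "state \<Rightarrow> bool" where "fails s = fst (snd (snd (snd s)))"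
definition exceeded :: "state \<Rightarrow> bool" where "exceeded s = snd (snd (snd (snd s)))"

lemma track_not_exceeded:
  "\<not> exceeded (track k a eta d z n) \<Longrightarrow> real (z n) / real k \<le> a"
  by (cases n) (auto simp: exceeded_def start_def step_def split: prod.splits if_splits)

text \<open>\<open>L\<close> is a Lipschitz constant of R_k on [0, 2], applied between 0 and another
  point; \<open>Kc\<close> is the constant of condition (C). The bound on \<open>C\<close> comes
  from the product of 1 + L / gam and 1 + Kc / gam, which exceeds 1 by at most C / gam.\<close>

locale scaled_branching = branching +
  fixes k :: nat and gam L Kc C :: real
  assumes k: "k \<ge> 1" and gam: "gam > 0" and L: "L \<ge> 0" and Kc: "Kc \<ge> 0"
    and C: "L + Kc + L * Kc / gam \<le> C"
    and g_close: "\<And>s. s \<in> {0..1} \<Longrightarrow> 1 - s \<le> 2 / real k \<Longrightarrow> \<bar>g s - s\<bar> \<le> L / gam * (1 - s)"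
    and h_close: "\<And>z s. s \<in> {0..1} \<Longrightarrow> 1 - h z s \<le> real k * Kc / gam * (1 + real z / real k) * (1 - s)"
begin

section \<open>One-step bounds for the mean and for Laplace transforms\<close>

lemma C_nonneg: "C \<ge> 0"
proof -
  have "0 \<le> L + Kc + L * Kc / gam" using L Kc gam by simp
  thus ?thesis using C by linarith
qed

lemma g_range: "s \<in> {0..1} \<Longrightarrow> g s \<in> {0..1}"
  using pgf_range[of "xi 0 0" s] xi_pgf[of s 0 0] by simp

lemma h_range: "s \<in> {0..1} \<Longrightarrow> h z s \<in> {0..1}"
  using pgf_range[of "\<lambda>w. psi 0 w z" s] psi_pgf[of s 0 z] by simp

lemma one_minus_g: "s \<in> {0..1} \<Longrightarrow> 1 - s \<le> 2 / real k \<Longrightarrow> 1 - g s \<le> (1 + L / gam) * (1 - s)"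
  using g_close[of s] by (simp add: algebra_simps abs_le_iff)

lemma one_minus_h_g:
  assumes "s \<in> {0..1}" "1 - s \<le> 2 / real k"
  shows "1 - h z (g s) \<le> real k * Kc / gam * (1 + real z / real k) * ((1 + L / gam) * (1 - s))"
proof -
  have "1 - h z (g s) \<le> real k * Kc / gam * (1 + real z / real k) * (1 - g s)"
    using g_range assms by (intro h_close) auto
  also have "\<dots> \<le> real k * Kc / gam * (1 + real z / real k) * ((1 + L / gam) * (1 - s))"
    using Kc gam by (intro mult_left_mono one_minus_g assms) auto
  finally show ?thesis .
qed

lemma mean_offspring:
  "(\<integral>\<^sup>+w. ennreal (real (offspring n z w)) \<partial>M)
     \<le> ennreal ((1 + L / gam) * (real z + real k * Kc / gam * (1 + real z / real k)))"
proof (rule mean_le_of_pgf[where ?s0.0 = "1 - 2 / real k"])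
  fix s :: real assume s: "1 - 2 / real k \<le> s" "0 \<le> s" "s < 1"
  hence s': "s \<in> {0..1}" "1 - s \<le> 2 / real k" by auto
  have gs: "g s \<in> {0..1}" by (rule g_range[OF s'(1)])
  have hs: "h z (g s) \<in> {0..1}" by (rule h_range[OF gs])
  have bern: "1 - g s ^ z \<le> real z * (1 - g s)"
    using Bernoulli_inequality[of "g s - 1" z] gs by (simp add: algebra_simps)
  have "1 - expectation (\<lambda>w. s ^ offspring n z w) = (1 - g s ^ z) + g s ^ z * (1 - h z (g s))"
    by (simp add: offspring_pgf[OF s'(1)] algebra_simps)
  also have "\<dots> \<le> real z * (1 - g s) + 1 * (1 - h z (g s))"
    using bern gs hs by (intro add_mono mult_right_mono) (auto simp: power_le_one)
  also have "\<dots> \<le> real z * ((1 + L / gam) * (1 - s))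
      + real k * Kc / gam * (1 + real z / real k) * ((1 + L / gam) * (1 - s))"
    using one_minus_h_g[OF s', of z] one_minus_g[OF s']
    by (intro add_mono mult_left_mono) auto
  also have "\<dots> = (1 + L / gam) * (real z + real k * Kc / gam * (1 + real z / real k)) * (1 - s)"
  proof -
    have "x * (u * t) + y * (u * t) = u * (x + y) * t" for x y u t :: real by (simp add: algebra_simps)
    thus ?thesis .
  qed
  finally show "1 - expectation (\<lambda>w. s ^ offspring n z w)
     \<le> (1 + L / gam) * (real z + real k * Kc / gam * (1 + real z / real k)) * (1 - s)" .
qed (use k in auto)

lemma mean_drift:
  "(\<integral>\<^sup>+w. ennreal (1 + real (offspring n z w) / real k) \<partial>M) \<le> ennreal ((1 + C / gam) * (1 + real z / real k))"
proof -
  define x where "x = real z / real k"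
  have x: "x \<ge> 0" "real z = real k * x" using k by (auto simp: x_def)
  have "(\<integral>\<^sup>+w. ennreal (1 + real (offspring n z w) / real k) \<partial>M)
      = (\<integral>\<^sup>+w. 1 + ennreal (1 / real k) * ennreal (real (offspring n z w)) \<partial>M)"
    by (intro nn_integral_cong, subst ennreal_plus) (auto simp: ennreal_mult'[symmetric])
  also have "\<dots> = 1 + ennreal (1 / real k) * (\<integral>\<^sup>+w. ennreal (real (offspring n z w)) \<partial>M)"
    by (simp add: nn_integral_add nn_integral_cmult emeasure_space_1)
  also have "\<dots> \<le> 1 + ennreal (1 / real k) * ennreal ((1 + L / gam) * (real z + real k * Kc / gam * (1 + real z / real k)))"
    by (intro add_left_mono mult_left_mono mean_offspring) auto
  also have "\<dots> = ennreal (1 + 1 / real k * ((1 + L / gam) * (real z + real k * Kc / gam * (1 + real z / real k))))"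
    using L Kc gam by (simp add: ennreal_mult'[symmetric])
  also have "1 + 1 / real k * ((1 + L / gam) * (real z + real k * Kc / gam * (1 + real z / real k)))
     = 1 + (1 + L / gam) * (x + Kc / gam * (1 + x))"
    unfolding x using k by (simp add: field_simps)
  also have "ennreal \<dots> \<le> ennreal ((1 + C / gam) * (1 + x))"
  proof (rule ennreal_leI)
    \<comment> \<open>Adding L / gam completes the expression to the product of 1 + L / gam, 1 + Kc
      / gam and 1 + x.\<close>
    have "1 + (1 + L / gam) * (x + Kc / gam * (1 + x))
        \<le> 1 + L / gam + (1 + L / gam) * (x + Kc / gam * (1 + x))" using L gam by simp
    also have "\<dots> = (1 + (L + Kc + L * Kc / gam) / gam) * (1 + x)"
      using gam by (simp add: field_simps)
    also have "\<dots> \<le> (1 + C / gam) * (1 + x)"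
      using C gam x by (intro mult_right_mono add_left_mono divide_right_mono) auto
    finally show "1 + (1 + L / gam) * (x + Kc / gam * (1 + x)) \<le> (1 + C / gam) * (1 + x)" .
  qed
  finally show ?thesis unfolding x_def .
qed

text \<open>The change splits into an offspring part, at most z times |g s - s|, and an immigration
  part, at most 1 - h z (g s). In both, a factor k (from z <= a * k, respectively from the
  immigration rate) cancels the 1 / k in 1 - s <= l / k, which leaves order 1 / gam.\<close>

lemma laplace_drift:
  assumes z: "real z / real k \<le> a" and l: "0 \<le> l" "l \<le> 2"
  shows "\<bar>expectation (\<lambda>w. exp (- l / real k) ^ offspring n z w) - exp (- l / real k) ^ z\<bar>
     \<le> l * (1 + a) * C / gam"
proof -
  define s where "s = exp (- l / real k)"
  have s: "s \<in> {0..1}" unfolding s_def using l by (simp add: divide_nonpos_nonneg)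
  have s1: "1 - s \<le> l / real k" unfolding s_def using exp_ge_add_one_self[of "- l / real k"] by simp
  also have "\<dots> \<le> 2 / real k" using l by (simp add: divide_right_mono)
  finally have s2: "1 - s \<le> 2 / real k" .
  have a: "a \<ge> 0" using z by (meson divide_nonneg_nonneg of_nat_0_le_iff order_trans)
  have zk: "real z \<le> a * real k" using z k by (simp add: divide_le_eq)
  have gs: "g s \<in> {0..1}" by (rule g_range[OF s])
  have hs: "h z (g s) \<in> {0..1}" by (rule h_range[OF gs])
  have "\<bar>g s ^ z - s ^ z\<bar> \<le> real z * \<bar>g s - s\<bar>"
    using norm_power_diff[of "g s" s z] gs s by simp
  also have "\<dots> \<le> (a * real k) * (L / gam * (l / real k))"
    using zk g_close[OF s s2] mult_left_mono[OF s1, of "L / gam"] L gam a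
    by (intro mult_mono) auto
  also have "\<dots> = l * (L * a) / gam" using k by simp
  finally have 1: "\<bar>g s ^ z - s ^ z\<bar> \<le> l * (L * a) / gam" .
  have "g s ^ z * (1 - h z (g s)) \<le> 1 * (1 - h z (g s))"
    using gs hs by (intro mult_right_mono) (auto simp: power_le_one)
  also have "\<dots> \<le> real k * Kc / gam * (1 + real z / real k) * ((1 + L / gam) * (1 - s))"
    using one_minus_h_g[OF s s2] by simp
  also have "\<dots> \<le> real k * Kc / gam * (1 + a) * ((1 + L / gam) * (l / real k))"
    using z s1 s Kc gam L a by (intro mult_mono) (auto intro!: mult_nonneg_nonneg add_nonneg_nonneg)
  also have "\<dots> = l * ((Kc + L * Kc / gam) * (1 + a)) / gam"
  proof -
    have "x * Kc / gam * (1 + a) * ((1 + L / gam) * (l / x)) = l * ((Kc + L * Kc / gam) * (1 + a)) / gam"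
      if "x > 0" for x using that gam by (simp add: field_simps)
    from this[of "real k"] show ?thesis using k by (metis of_nat_0_less_iff less_le_trans zero_less_one)
  qed
  finally have 2: "g s ^ z * (1 - h z (g s)) \<le> l * ((Kc + L * Kc / gam) * (1 + a)) / gam" .
  have 3: "0 \<le> g s ^ z * (1 - h z (g s))" using gs hs by auto
  have "\<bar>g s ^ z * h z (g s) - s ^ z\<bar> \<le> \<bar>g s ^ z - s ^ z\<bar> + g s ^ z * (1 - h z (g s))"
    using 3 by (simp add: algebra_simps abs_le_iff)
  also have "\<dots> \<le> l * (L * a) / gam + l * ((Kc + L * Kc / gam) * (1 + a)) / gam" using 1 2 by simp
  also have "\<dots> = l * (L * a + (Kc + L * Kc / gam) * (1 + a)) / gam" by (simp add: algebra_simps add_divide_distrib)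
  also have "\<dots> \<le> l * ((1 + a) * C) / gam"
  proof (intro divide_right_mono mult_left_mono)
    have "L * a + (Kc + L * Kc / gam) * (1 + a) \<le> (1 + a) * (L + Kc + L * Kc / gam)"
      using L by (simp add: algebra_simps)
    also have "\<dots> \<le> (1 + a) * C" using C a by (intro mult_left_mono) auto
    finally show "L * a + (Kc + L * Kc / gam) * (1 + a) \<le> (1 + a) * C" .
  qed (use l gam in auto)
  finally show ?thesis unfolding s_def[symmetric] offspring_pgf[OF s]
    by (simp add: mult.assoc)
qed

text \<open>Scaled so that a reset happens exactly when this squared displacement is at least 1; it
  can then pay for the indicator of a reset.\<close>

definition dev :: "real \<Rightarrow> nat \<Rightarrow> nat \<Rightarrow> real" where
  "dev eta z r = ((exp (- (real z / real k)) - exp (- (real r / real k))) / eta)\<^sup>2"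

lemma dev_ge_1:
  assumes "\<bar>exp (- (real z / real k)) - exp (- (real r / real k))\<bar> \<ge> eta" "eta > 0"
  shows "dev eta z r \<ge> 1"
proof -
  have "1 \<le> \<bar>(exp (- (real z / real k)) - exp (- (real r / real k))) / eta\<bar>" using assms by simp
  hence "1\<^sup>2 \<le> \<bar>(exp (- (real z / real k)) - exp (- (real r / real k))) / eta\<bar>\<^sup>2"
    by (intro power_mono) auto
  thus ?thesis unfolding dev_def power2_abs by simp
qed

lemma dev_nonneg: "dev eta z r \<ge> 0" by (simp add: dev_def)

lemma dev_self: "dev eta z z = 0" by (simp add: dev_def)

text \<open>Expanding the square leaves the transforms at 1 and 2. Their drifts are at most b and 2
  * b with b = (1 + a) * C / gam, and the first enters with a factor 2 * R <= 2, which explains the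
  constant 4. The affine form with \<open>c0\<close> and \<open>c1\<close> is the shape of the
  Lyapunov function after one step.\<close>

lemma dev_drift:
  assumes z: "real z / real k \<le> a" and eta: "eta > 0" and c: "c0 \<ge> 0" "c1 \<ge> 0"
  shows "(\<integral>\<^sup>+w. ennreal (c0 + c1 * dev eta (offspring n z w) r) \<partial>M)
      \<le> ennreal (c0 + c1 * (dev eta z r + 4 * (1 + a) * C / eta\<^sup>2 / gam))"
proof -
  define R where "R = exp (- (real r / real k))"
  have R: "0 \<le> R" "R \<le> 1" by (auto simp: R_def)
  define e1 where "e1 w = exp (- 1 / real k) ^ offspring n z w" for w
  define e2 where "e2 w = exp (- 2 / real k) ^ offspring n z w" for w
  have dev_eq: "dev eta v r = (exp (- 2 / real k) ^ v - 2 * R * exp (- 1 / real k) ^ v + R\<^sup>2) / eta\<^sup>2" for v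
  proof -
    have "exp (- 1 / real k) ^ v = exp (- (real v / real k))" "exp (- 2 / real k) ^ v = (exp (- (real v / real k)))\<^sup>2"
      by (simp_all add: exp_of_nat_mult[symmetric] power2_eq_square exp_add[symmetric] field_simps)
    thus ?thesis by (simp add: dev_def R_def power_divide power2_eq_square algebra_simps)
  qed
  have I: "integrable M e1" "integrable M e2"
    unfolding e1_def e2_def by (auto intro!: integrable_power_nat simp: divide_nonpos_nonneg)
  have eq: "c0 + c1 * dev eta (offspring n z w) r = c0 + c1 * ((e2 w - 2 * R * e1 w + R\<^sup>2) / eta\<^sup>2)" for w
    by (simp add: dev_eq e1_def e2_def)
  have I': "integrable M (\<lambda>w. c0 + c1 * dev eta (offspring n z w) r)"
    unfolding eq using I by simp
  have "(\<integral>\<^sup>+w. ennreal (c0 + c1 * dev eta (offspring n z w) r) \<partial>M)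
     = ennreal (expectation (\<lambda>w. c0 + c1 * dev eta (offspring n z w) r))"
    using I' c dev_nonneg by (intro nn_integral_eq_integral) auto
  also have "expectation (\<lambda>w. c0 + c1 * dev eta (offspring n z w) r)
     = c0 + c1 * ((expectation e2 - 2 * R * expectation e1 + R\<^sup>2) / eta\<^sup>2)"
    unfolding eq using I by (simp add: prob_space)
  also have "\<dots> \<le> c0 + c1 * (dev eta z r + 4 * (1 + a) * C / eta\<^sup>2 / gam)"
  proof (intro add_left_mono mult_left_mono c)
    let ?B = "(1 + a) * C / gam"
    have a: "a \<ge> 0" using z by (meson divide_nonneg_nonneg of_nat_0_le_iff order_trans)
    have B: "?B \<ge> 0" using a C_nonneg gam by simp
    have 1: "\<bar>expectation e1 - exp (- 1 / real k) ^ z\<bar> \<le> ?B"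
      using laplace_drift[OF z, of 1 n] unfolding e1_def by simp
    have 2: "\<bar>expectation e2 - exp (- 2 / real k) ^ z\<bar> \<le> 2 * ?B"
      using laplace_drift[OF z, of 2 n] unfolding e2_def by (simp add: algebra_simps)
    have "R * (exp (- 1 / real k) ^ z - expectation e1) \<le> 1 * ?B"
    proof -
      have "R * (exp (- 1 / real k) ^ z - expectation e1) \<le> R * ?B"
        using 1 R by (intro mult_left_mono) auto
      also have "\<dots> \<le> 1 * ?B" using R B by (intro mult_right_mono)
      finally show ?thesis .
    qed
    moreover have "E2 - 2 * R * E1 + R\<^sup>2 \<le> (p2 - 2 * R * p1 + R\<^sup>2) + 4 * b"
      if "R * (p1 - E1) \<le> 1 * b" "\<bar>E2 - p2\<bar> \<le> 2 * b" for E1 E2 p1 p2 b :: real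
      using that by (simp add: algebra_simps abs_le_iff)
    ultimately have "expectation e2 - 2 * R * expectation e1 + R\<^sup>2
      \<le> (exp (- 2 / real k) ^ z - 2 * R * exp (- 1 / real k) ^ z + R\<^sup>2) + 4 * ?B"
      using 2 by blast
    hence "(expectation e2 - 2 * R * expectation e1 + R\<^sup>2) / eta\<^sup>2
      \<le> ((exp (- 2 / real k) ^ z - 2 * R * exp (- 1 / real k) ^ z + R\<^sup>2) + 4 * ?B) / eta\<^sup>2"
      by (intro divide_right_mono) auto
    also have "\<dots> = dev eta z r + 4 * (1 + a) * C / eta\<^sup>2 / gam"
      unfolding dev_eq add_divide_distrib by (simp add: mult.assoc mult.commute[of gam])
    finally show "(expectation e2 - 2 * R * expectation e1 + R\<^sup>2) / eta\<^sup>2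
      \<le> dev eta z r + 4 * (1 + a) * C / eta\<^sup>2 / gam" .
  qed
  finally show ?thesis by (simp add: ennreal_leI)
qed

text \<open>A maximal inequality by freezing: \<open>V\<close> stays at 1 + a once the level has
  been exceeded, so it grows in mean by a factor of at most 1 + C / gam per step, and Markov's
  inequality at the final step \<open>N\<close> controls the whole path.\<close>

lemma exceed_prob:
  assumes a: "a \<ge> 0" and N: "real N \<le> gam * H"
    and mean: "(\<integral>\<^sup>+w. ennreal (real (Z0 w) / real k) \<partial>M) \<le> ennreal m" and m: "m \<ge> 0"
  shows "prob {w \<in> space M. exceeded (track k a eta d (Zp w) N)} \<le> exp (C * H) * (1 + m) / (1 + a)"
proof -
  define V where "V s = ennreal (if exceeded s then 1 + a else 1 + real (fst s) / real k)" for s :: state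
  have V_step: "V (step k a eta d s v) \<le> ennreal (if exceeded s then 1 + a else 1 + real v / real k)" for s v
    using a by (auto simp: V_def step_def exceeded_def split: prod.splits intro!: ennreal_leI)
  have drift: "(\<integral>\<^sup>+w. V (step k a eta d s (offspring n (fst s) w)) \<partial>M) \<le> ennreal (1 + C / gam) * V s + 0" for n s
  proof -
    have "(\<integral>\<^sup>+w. V (step k a eta d s (offspring n (fst s) w)) \<partial>M)
       \<le> (\<integral>\<^sup>+w. ennreal (if exceeded s then 1 + a else 1 + real (offspring n (fst s) w) / real k) \<partial>M)"
      by (intro nn_integral_mono V_step)
    also have "\<dots> \<le> ennreal (1 + C / gam) * V s"
    proof (cases "exceeded s")
      case True
      have "1 * (1 + a) \<le> (1 + C / gam) * (1 + a)" using C_nonneg gam a by (intro mult_right_mono) auto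
      thus ?thesis using True a C_nonneg gam
        by (simp add: V_def emeasure_space_1 ennreal_mult[symmetric] del: ennreal_plus)
    next
      case False
      thus ?thesis using mean_drift[of n "fst s"] C_nonneg gam
        by (simp add: V_def ennreal_mult[symmetric] del: ennreal_plus)
    qed
    finally show ?thesis by simp
  qed
  have V_bound: "(\<integral>\<^sup>+w. V (track k a eta d (Zp w) n) \<partial>M) \<le> ennreal ((1 + C / gam) ^ n * (1 + m))" for n
  proof (induction n)
    case 0
    have "(\<integral>\<^sup>+w. V (track k a eta d (Zp w) 0) \<partial>M) \<le> (\<integral>\<^sup>+w. 1 + ennreal (real (Z0 w) / real k) \<partial>M)"
    proof (rule nn_integral_mono)
      fix w
      have "V (track k a eta d (Zp w) 0) \<le> ennreal (1 + real (Z0 w) / real k)"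
        using a by (auto simp: V_def start_def exceeded_def Zp_def intro!: ennreal_leI)
      also have "\<dots> = 1 + ennreal (real (Z0 w) / real k)" by (subst ennreal_plus) auto
      finally show "V (track k a eta d (Zp w) 0) \<le> 1 + ennreal (real (Z0 w) / real k)" .
    qed
    also have "\<dots> = 1 + (\<integral>\<^sup>+w. ennreal (real (Z0 w) / real k) \<partial>M)"
    proof -
      have "Z0 \<in> measurable M (count_space UNIV)" using measurable_Zp[of 0] by (simp add: Zp_def)
      thus ?thesis by (simp add: nn_integral_add emeasure_space_1)
    qed
    also have "\<dots> \<le> 1 + ennreal m" using mean by (rule add_left_mono)
    finally show ?case using m by simp
  next
    case (Suc n)
    have "(\<integral>\<^sup>+w. V (track k a eta d (Zp w) (Suc n)) \<partial>M)
      \<le> ennreal (1 + C / gam) * (\<integral>\<^sup>+w. V (track k a eta d (Zp w) n) \<partial>M) + 0"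
      by (intro track_drift drift)
    also have "\<dots> \<le> ennreal (1 + C / gam) * ennreal ((1 + C / gam) ^ n * (1 + m))"
      using Suc by (simp add: mult_left_mono)
    finally show ?case using C_nonneg gam m by (simp add: ennreal_mult[symmetric] mult.assoc del: ennreal_plus)
  qed
  let ?E = "{w \<in> space M. exceeded (track k a eta d (Zp w) N)}"
  have "?E \<in> sets M" by measurable
  have "ennreal (1 + a) * emeasure M ?E = (\<integral>\<^sup>+w. ennreal (1 + a) * indicator ?E w \<partial>M)"
    by (rule nn_integral_cmult_indicator[symmetric]) fact
  also have "\<dots> \<le> (\<integral>\<^sup>+w. V (track k a eta d (Zp w) N) \<partial>M)"
    by (intro nn_integral_mono) (auto simp: V_def indicator_def)
  also have "\<dots> \<le> ennreal ((1 + C / gam) ^ N * (1 + m))" by (rule V_bound)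
  finally have "(1 + a) * prob ?E \<le> (1 + C / gam) ^ N * (1 + m)"
    using a m C_nonneg gam by (simp add: emeasure_eq_measure ennreal_mult[symmetric] del: ennreal_plus)
  also have "\<dots> \<le> exp (C * H) * (1 + m)"
  proof (intro mult_right_mono)
    have "(1 + C / gam) ^ N \<le> exp (C / gam) ^ N" using C_nonneg gam exp_ge_add_one_self[of "C / gam"]
      by (intro power_mono) auto
    also have "\<dots> = exp (C / gam * real N)" by (simp add: exp_of_nat_mult[symmetric] mult.commute)
    also have "C / gam * real N \<le> C / gam * (gam * H)" using N C_nonneg gam by (intro mult_left_mono) auto
    also have "C / gam * (gam * H) = C * H" using gam by simp
    finally show "(1 + C / gam) ^ N \<le> exp (C * H)" by simp
  qed (use m in auto)
  finally show ?thesis using a by (simp add: pos_le_divide_eq mult.commute)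
qed

text \<open>Heuristically, with B = B0 / gam, a reset is followed by another within d steps with
  probability at most B * d, and at most N * B resets are expected besides time 0. The product B * d
  * (1 + N * B) is the bound. Setting \<open>V\<close> to 0 once the level is exceeded confines the
  drift estimate to populations below it.\<close>

lemma oscillation_prob:
  assumes a: "a \<ge> 0" and N: "real N \<le> gam * H" and eta: "eta > 0" and d: "real d \<le> del * gam"
  defines "B0 \<equiv> 4 * (1 + a) * C / eta\<^sup>2"
  shows "prob {w \<in> space M. fails (track k a eta d (Zp w) N) \<and> \<not> exceeded (track k a eta d (Zp w) N)}
     \<le> del * B0 * (1 + H * B0)"
proof -
  define B where "B = B0 / gam"
  have B: "B \<ge> 0" unfolding B_def B0_def using C_nonneg gam a by simp
  \<comment> \<open>\<open>B\<close> bounds the drift of \<open>dev\<close>. While the age is below \<open>d\<close>, the middle term is a supermartingale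
    that pays for a failure, and the last one pays the amount \<open>B * d\<close> needed to start it at a reset.\<close>
  define \<Phi> where "\<Phi> z ref age bad = of_bool bad
      + (if age < d then dev eta z ref + B * (real d - real age) else 0) + B * real d * dev eta z ref"
    for z ref age :: nat and bad :: bool
  have \<Phi>_bad: "of_bool bad \<le> \<Phi> z ref age bad" for z ref age bad
    unfolding \<Phi>_def using B dev_nonneg[of eta z ref] by (auto intro!: add_nonneg_nonneg mult_nonneg_nonneg)
  define V where "V = (\<lambda>(z, ref, age, bad, ex). if ex then 0 else ennreal (\<Phi> z ref age bad))"
  have drift: "(\<integral>\<^sup>+w. V (step k a eta d s (offspring n (fst s) w)) \<partial>M) \<le> 1 * V s + ennreal (B\<^sup>2 * real d)"
    if reach: "s \<in> range (\<lambda>w. track k a eta d (Zp w) n)" for n s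
  proof -
    obtain z ref age bad ex where s: "s = (z, ref, age, bad, ex)" by (cases s)
    show ?thesis
    proof (cases ex)
      case True
      hence "V (step k a eta d s v) = 0" for v by (simp add: V_def s step_def)
      thus ?thesis by simp
    next
      case False
      have z: "real z / real k \<le> a"
      proof -
        from reach obtain w0 where w0: "s = track k a eta d (Zp w0) n" by auto
        have "\<not> exceeded (track k a eta d (Zp w0) n)" unfolding w0[symmetric] s using False by (simp add: exceeded_def)
        from track_not_exceeded[OF this] show ?thesis
          using fst_track[of k a eta d "Zp w0" n] unfolding w0[symmetric] s by simp
      qed
      \<comment> \<open>\<open>c0\<close> and \<open>c1\<close> dominate both outcomes of the step:
        at a reset \<open>dev\<close> is at least 1 and pays for the failure and for the next
        countdown. While the age is below \<open>d\<close>, the unit drop of the countdown releases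
        \<open>B\<close> and cancels the drift of the middle term. What remains is \<open>B\<close>
        times \<open>B * d\<close>, the drift of the last term.\<close>
      define c0 where "c0 = of_bool bad + (if age < d then B * (real d - real age - 1) else 0)"
      define c1 where "c1 = of_bool (age < d) + B * real d"
      have c: "c0 \<ge> 0" "c1 \<ge> 0" unfolding c0_def c1_def using B by auto
      have V_step: "V (step k a eta d s v) \<le> ennreal (c0 + c1 * dev eta v ref)" for v
      proof (cases "\<bar>exp (- (real v / real k)) - exp (- (real ref / real k))\<bar> \<ge> eta")
        case True
        hence dv: "1 \<le> dev eta v ref" using eta by (rule dev_ge_1)
        have "\<Phi> v v 0 (bad \<or> Suc age \<le> d) = of_bool (bad \<or> age < d) + B * real d"
          by (simp add: \<Phi>_def dev_self Suc_le_eq)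
        also have "\<dots> \<le> (of_bool bad + of_bool (age < d)) + B * real d" by simp
        also have "\<dots> \<le> c0 + c1 * 1" unfolding c0_def c1_def using B by auto
        also have "\<dots> \<le> c0 + c1 * dev eta v ref" using c dv by (intro add_left_mono mult_left_mono)
        finally show ?thesis using True False by (simp add: V_def s step_def ennreal_leI)
      next
        case nj: False
        have "\<Phi> v ref (Suc age) bad \<le> c0 + c1 * dev eta v ref"
        proof -
          have "B * (real age + 1) \<le> B * real d" if "age < d" using B that by (intro mult_left_mono) auto
          thus ?thesis unfolding \<Phi>_def c0_def c1_def using dev_nonneg[of eta v ref]
            by (auto simp: algebra_simps)
        qed
        thus ?thesis using nj False by (simp add: V_def s step_def ennreal_leI)
      qed
      have "(\<integral>\<^sup>+w. V (step k a eta d s (offspring n (fst s) w)) \<partial>M)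
        \<le> (\<integral>\<^sup>+w. ennreal (c0 + c1 * dev eta (offspring n z w) ref) \<partial>M)"
        using V_step by (intro nn_integral_mono) (simp add: s)
      also have "\<dots> \<le> ennreal (c0 + c1 * (dev eta z ref + B))"
        using dev_drift[OF z eta c, of n ref] unfolding B_def B0_def .
      also have "\<dots> \<le> ennreal (\<Phi> z ref age bad + B\<^sup>2 * real d)"
        by (intro ennreal_leI) (auto simp: c0_def c1_def \<Phi>_def algebra_simps power2_eq_square B)
      also have "\<dots> = V s + ennreal (B\<^sup>2 * real d)"
        using False order_trans[OF _ \<Phi>_bad[of bad z ref age], of 0] B by (simp add: V_def s ennreal_plus)
      finally show ?thesis by simp
    qed
  qed
  have V_bound: "(\<integral>\<^sup>+w. V (track k a eta d (Zp w) n) \<partial>M) \<le> ennreal (B * real d + real n * (B\<^sup>2 * real d))" for n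
  proof (induction n)
    case 0
    have "(\<integral>\<^sup>+w. V (track k a eta d (Zp w) 0) \<partial>M) \<le> (\<integral>\<^sup>+w. ennreal (B * real d) \<partial>M)"
      using B by (intro nn_integral_mono) (simp add: V_def start_def \<Phi>_def dev_self)
    thus ?case by (simp add: emeasure_space_1)
  next
    case (Suc n)
    have "(\<integral>\<^sup>+w. V (track k a eta d (Zp w) (Suc n)) \<partial>M)
      \<le> 1 * (\<integral>\<^sup>+w. V (track k a eta d (Zp w) n) \<partial>M) + ennreal (B\<^sup>2 * real d)"
      by (intro track_drift drift)
    also have "\<dots> \<le> ennreal (B * real d + real n * (B\<^sup>2 * real d)) + ennreal (B\<^sup>2 * real d)"
      using Suc by (simp add: add_right_mono)
    also have "\<dots> = ennreal (B * real d + real (Suc n) * (B\<^sup>2 * real d))"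
      using B by (simp add: ennreal_plus[symmetric] algebra_simps del: ennreal_plus)
    finally show ?case .
  qed
  let ?E = "{w \<in> space M. fails (track k a eta d (Zp w) N) \<and> \<not> exceeded (track k a eta d (Zp w) N)}"
  have E: "?E \<in> sets M" by measurable
  have "emeasure M ?E = (\<integral>\<^sup>+w. indicator ?E w \<partial>M)" using E by simp
  also have "\<dots> \<le> (\<integral>\<^sup>+w. V (track k a eta d (Zp w) N) \<partial>M)"
  proof (rule nn_integral_mono)
    fix w
    obtain z ref age bad ex where s: "track k a eta d (Zp w) N = (z, ref, age, bad, ex)"
      by (cases "track k a eta d (Zp w) N")
    show "indicator ?E w \<le> V (track k a eta d (Zp w) N)"
      unfolding s V_def using \<Phi>_bad[of bad z ref age]
      by (auto simp: indicator_def fails_def exceeded_def s simp flip: ennreal_1 intro!: ennreal_leI)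
  qed
  also have "\<dots> \<le> ennreal (B * real d + real N * (B\<^sup>2 * real d))" by (rule V_bound)
  finally have "prob ?E \<le> B * real d + real N * (B\<^sup>2 * real d)"
    using B by (simp add: emeasure_eq_measure del: ennreal_plus)
  also have "\<dots> = B * real d * (1 + real N * B)" by (simp add: algebra_simps power2_eq_square)
  also have "\<dots> \<le> (del * B0) * (1 + H * B0)"
  proof (rule mult_mono)
    have "B * real d \<le> B * (del * gam)" using d B by (rule mult_left_mono)
    thus "B * real d \<le> del * B0" using gam by (simp add: B_def mult.commute)
    have "real N * B \<le> (gam * H) * B" using N B by (rule mult_right_mono)
    thus "1 + real N * B \<le> 1 + H * B0" using gam by (simp add: B_def)
    have "0 \<le> del * gam" using d by (rule order_trans[rotated]) simp
    hence "0 \<le> del" using gam by (simp add: zero_le_mult_iff)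
    moreover have "B0 \<ge> 0" unfolding B0_def using C_nonneg a by simp
    ultimately show "0 \<le> del * B0" by simp
  qed (use B in auto)
  finally show ?thesis .
qed

end

section \<open>Tightness\<close>

context scaled_branching
begin

text \<open>Level j has failure budget e / 2 ^ (j + 1), half for exceeding and half for oscillation,
  and the budgets sum to e. The complement of the countable union of these events is the measurable
  set required for inner probability.\<close>

lemma block_paths_prob:
  assumes mean: "(\<integral>\<^sup>+w. ennreal (real (Z0 w) / real k) \<partial>M) \<le> ennreal m" and m: "m \<ge> 0" and e: "e > 0"
    and a: "\<And>j. a j \<ge> 0" and eta: "\<And>j. eta j > 0" "\<And>j. exp (a j) * eta j \<le> 1 / real (Suc j)"
    and del: "\<And>j. del j > 0"
    and exceed: "\<And>j. exp (C * real j) * (1 + m) / (1 + a j) \<le> e / 2 ^ (j + 2)"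
    and oscillate: "\<And>j. del j * (4 * (1 + a j) * C / (eta j)\<^sup>2) * (1 + real j * (4 * (1 + a j) * C / (eta j)\<^sup>2))
        \<le> e / 2 ^ (j + 2)"
  shows "\<exists>A\<in>sets M. A \<subseteq> {w \<in> space M. Ypath (Zp w) gam k \<in> block_paths del a} \<and> prob A \<ge> 1 - e"
proof -
  \<comment> \<open>Rounding down keeps the probability bound, and a gap of more than d steps still
    lasts at least \<open>del j\<close>. If \<open>del j * gam\<close> is below 1, then d is 0 and
    no failure can occur: one time step is already long enough.\<close>
  define d where "d j = nat \<lfloor>del j * gam\<rfloor>" for j
  define N where "N j = nat \<lfloor>gam * real j\<rfloor>" for j
  define T where "T j w = track k (a j) (eta j) (d j) (Zp w) (N j)" for j w
  have T[measurable]: "T j \<in> measurable M (count_space UNIV)" for j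
    unfolding T_def[abs_def] by measurable
  have N: "real (N j) \<le> gam * real j" for j unfolding N_def using gam by simp
  have d: "real (d j) \<le> del j * gam" "del j * gam \<le> real (Suc (d j))" for j
  proof -
    have "0 \<le> del j * gam" using gam del[of j] by simp
    thus "real (d j) \<le> del j * gam" "del j * gam \<le> real (Suc (d j))" unfolding d_def by linarith+
  qed
  define E where "E j = {w \<in> space M. exceeded (T j w)} \<union> {w \<in> space M. fails (T j w) \<and> \<not> exceeded (T j w)}" for j
  have E[measurable]: "E j \<in> sets M" for j unfolding E_def by measurable
  have E_prob: "prob (E j) \<le> e * (1/2) ^ Suc j" for j
  proof -
    have "prob (E j) \<le> prob {w \<in> space M. exceeded (T j w)} + prob {w \<in> space M. fails (T j w) \<and> \<not> exceeded (T j w)}"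
      unfolding E_def by (intro measure_Un_le) measurable
    also have "\<dots> \<le> exp (C * real j) * (1 + m) / (1 + a j)
       + del j * (4 * (1 + a j) * C / (eta j)\<^sup>2) * (1 + real j * (4 * (1 + a j) * C / (eta j)\<^sup>2))"
      unfolding T_def using mean m a eta(1) N d(1) by (intro add_mono exceed_prob oscillation_prob) auto
    also have "\<dots> \<le> e / 2 ^ (j + 2) + e / 2 ^ (j + 2)" by (intro add_mono exceed oscillate)
    also have "\<dots> = e * (1/2) ^ Suc j" by (simp add: power_divide)
    finally show ?thesis .
  qed
  have sums: "(\<lambda>j. e * (1/2) ^ Suc j) sums (e * 1)"
    by (intro sums_mult power_half_series)
  have summ: "summable (\<lambda>j. prob (E j))"
    by (rule summable_comparison_test'[OF sums_summable[OF sums], of 0]) (use E_prob in simp)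
  have "prob (\<Union>j. E j) \<le> (\<Sum>j. prob (E j))"
    by (rule finite_measure_subadditive_countably) (use summ in auto)
  also have "\<dots> \<le> (\<Sum>j. e * (1/2) ^ Suc j)"
    by (rule suminf_le[OF E_prob summ sums_summable[OF sums]])
  also have "\<dots> = e" using sums_unique[OF sums] by simp
  finally have P: "prob (\<Union>j. E j) \<le> e" .
  show ?thesis
  proof (rule bexI[of _ "space M - (\<Union>j. E j)"], rule conjI)
    show "space M - (\<Union>j. E j) \<subseteq> {w \<in> space M. Ypath (Zp w) gam k \<in> block_paths del a}"
    proof
      fix w assume w: "w \<in> space M - (\<Union>j. E j)"
      have "\<exists>t y. block_approx (real j) (del j) (1 / real (Suc j)) (a j) (Ypath (Zp w) gam k) t y" for j
      proof -
        have "\<not> exceeded (T j w)" "\<not> fails (T j w)" using w by (auto simp: E_def)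
        then obtain z ref age where "T j w = (z, ref, age, False, False)"
          by (cases "T j w") (auto simp: exceeded_def fails_def)
        thus ?thesis unfolding T_def N_def
          by (rule track_block_approx) (use eta gam del d in auto)
      qed
      thus "w \<in> {w \<in> space M. Ypath (Zp w) gam k \<in> block_paths del a}"
        using w Ypath_skorokhod_D[OF gam] by (simp add: block_paths_def)
    qed
    show "1 - e \<le> prob (space M - (\<Union>j. E j))" using P by (subst prob_compl) auto
  qed measurable
qed

end

theorem theorem3p5:
  fixes M :: "'a measure"
    and xi :: "nat \<Rightarrow> nat \<Rightarrow> nat \<Rightarrow> 'a \<Rightarrow> nat"   (* xi k n i w = xi^{(k)}_{n,i} *)
    and psi :: "nat \<Rightarrow> nat \<Rightarrow> 'a \<Rightarrow> nat \<Rightarrow> nat"  (* psi k n w i = psi^{(n)}_k(i) *)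
    and Z0 :: "nat \<Rightarrow> 'a \<Rightarrow> nat"
    and g :: "nat \<Rightarrow> real \<Rightarrow> real" and h :: "nat \<Rightarrow> nat \<Rightarrow> real \<Rightarrow> real"
    and gam :: "nat \<Rightarrow> real"
    and b c :: real and m :: "real measure" and pi :: "real measure"
    and beta :: "real \<Rightarrow> real" and q :: "real \<Rightarrow> real \<Rightarrow> real"
    and r :: "real \<Rightarrow> real" and K K1 :: real
  assumes M: "prob_space M"
  (* for each k: all offspring variables xi k n i, the random functions psi k n,
     and Z0 k are mutually independent (scalars encoded as constant functions) *)
  and indep: "\<And>k. k \<ge> 1 \<Longrightarrow>
        prob_space.indep_vars M (\<lambda>_. PiM UNIV (\<lambda>_. count_space UNIV))
          (\<lambda>j w. case j of Inl (n, i) \<Rightarrow> (\<lambda>_. xi k n i w)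
                           | Inr (Some n) \<Rightarrow> psi k n w
                           | Inr None \<Rightarrow> (\<lambda>_. Z0 k w)) UNIV"
  (* offspring: identically distributed with pgf g k *)
  and xi_pgf: "\<And>k n i s. k \<ge> 1 \<Longrightarrow> s \<in> {0..1} \<Longrightarrow>
        prob_space.expectation M (\<lambda>w. s ^ xi k n i w) = g k s"
  (* random functions psi: identically distributed in n, psi k n (i) has pgf h k i *)
  and psi_ident: "\<And>k n. k \<ge> 1 \<Longrightarrow>
        distr M (PiM UNIV (\<lambda>_. count_space UNIV)) (psi k n)
          = distr M (PiM UNIV (\<lambda>_. count_space UNIV)) (psi k 0)"
  and psi_pgf: "\<And>k n i s. k \<ge> 1 \<Longrightarrow> s \<in> {0..1} \<Longrightarrow>
        prob_space.expectation M (\<lambda>w. s ^ psi k n w i) = h k i s"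
  (* scaling constants *)
  and gam_pos: "\<And>k. k \<ge> 1 \<Longrightarrow> gam k > 0"
  and gam_mono: "mono_on {1..} gam"
  and gam_lim: "filterlim gam at_top sequentially"
  (* parameters *)
  and c_nonneg: "c \<ge> 0"
  and m_sets: "sets m = sets borel" and m_supp: "emeasure m {..0} = 0"
  and m_int: "(\<integral>\<^sup>+ z\<in>{0<..}. ennreal (min z (z\<^sup>2)) \<partial>m) < \<infinity>"
  and pi_sets: "sets pi = sets borel" and pi_supp: "emeasure pi {..0} = 0"
  and pi_sigma: "sigma_finite_measure pi"
  and beta_meas: "beta \<in> borel_measurable borel"
  and beta_nonneg: "\<And>x. x \<ge> 0 \<Longrightarrow> beta x \<ge> 0"
  and q_meas: "\<And>x. (\<lambda>z. q x z) \<in> borel_measurable borel"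
  and q_nonneg: "\<And>x z. x \<ge> 0 \<Longrightarrow> z > 0 \<Longrightarrow> q x z \<ge> 0"
  and S1: "\<And>x. x \<ge> 0 \<Longrightarrow>
        ennreal \<bar>beta x\<bar> + (\<integral>\<^sup>+ z\<in>{0<..}. ennreal (q x z * z) \<partial>pi) \<le> ennreal (K * (1 + x))"
  and S2: "\<And>x y. x \<ge> 0 \<Longrightarrow> y \<ge> 0 \<Longrightarrow>
        ennreal \<bar>beta x - beta y\<bar> + (\<integral>\<^sup>+ z\<in>{0<..}. ennreal (\<bar>q x z - q y z\<bar> * z) \<partial>pi)
          \<le> ennreal (r \<bar>x - y\<bar>)"
  and r_mono: "mono_on {0..} r" and r_concave: "concave_on {0..} r"
  and r_nonneg: "\<And>z. z \<ge> 0 \<Longrightarrow> r z \<ge> 0"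
  and r_int: "(\<integral>\<^sup>+ z\<in>{0<..1}. inverse (ennreal (r z)) \<partial>lborel) = \<infinity>"
  (* condition (A) *)
  and condA_lip: "\<And>a. a > 0 \<Longrightarrow> \<exists>L. \<forall>k\<ge>1. \<forall>l1\<in>{0..min a (real k)}. \<forall>l2\<in>{0..min a (real k)}.
        \<bar>real k * gam k * (g k (1 - l1 / real k) - (1 - l1 / real k))
          - real k * gam k * (g k (1 - l2 / real k) - (1 - l2 / real k))\<bar> \<le> L * \<bar>l1 - l2\<bar>"
  and condA_lim: "\<And>l. l \<ge> 0 \<Longrightarrow>
        ((\<lambda>k. real k * gam k * (g k (1 - l / real k) - (1 - l / real k)))
          \<longlongrightarrow> b * l + c * l\<^sup>2 + (LINT z:{0<..}|m. exp (- l * z) - 1 + l * z)) sequentially"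
  (* condition (B) *)
  and condB: "\<And>a1 a2 e. a1 > 0 \<Longrightarrow> a2 > 0 \<Longrightarrow> e > 0 \<Longrightarrow>
        eventually (\<lambda>k. \<forall>l\<in>{0..a1}. \<forall>x\<in>{0..a2}.
          \<bar>gam k * (h k (nat \<lfloor>real k * x\<rfloor>) (1 - l / real k) - (1 - l / real k))
            - (- beta x * l + (LINT z:{0<..}|pi. (exp (- l * z) - 1) * q x z))\<bar> < e) sequentially"
  (* condition (C) *)
  and condC: "K1 > 0" "\<And>k x. k \<ge> 1 \<Longrightarrow> x \<ge> 0 \<Longrightarrow>
        \<exists>D. (deriv (h k (nat \<lfloor>real k * x\<rfloor>)) \<longlongrightarrow> D) (at_left 1)
            \<and> gam k / real k * D \<le> K1 * (1 + x)"
  (* condition (D) *)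
  and condD: "(SUP k\<in>{1..}. \<integral>\<^sup>+ w. ennreal (real (Z0 k w) / real k) \<partial>M) < \<infinity>"
  shows "skorokhod_tight M
           (\<lambda>k w. Ypath (Zproc (\<lambda>n i. xi k n i w) (\<lambda>n. psi k n w) (Z0 k w)) (gam k) k)"
proof -
  interpret prob_space M by (rule M)
  \<comment> \<open>The interval reaches 2 because exp (- 2 / k) lies within 2 / k of 1.\<close>
  obtain L0 where L0: "\<And>k l1 l2. k \<ge> 1 \<Longrightarrow> l1 \<in> {0..min 2 (real k)} \<Longrightarrow> l2 \<in> {0..min 2 (real k)} \<Longrightarrow>
        \<bar>real k * gam k * (g k (1 - l1 / real k) - (1 - l1 / real k))
          - real k * gam k * (g k (1 - l2 / real k) - (1 - l2 / real k))\<bar> \<le> L0 * \<bar>l1 - l2\<bar>"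
    using condA_lip[OF zero_less_numeral, of "num.Bit0 num.One"] by blast
  define L where "L = max L0 0"
  \<comment> \<open>Since gam increases, its first value gives a constant valid for all k.\<close>
  define C where "C = L + K1 + L * K1 / gam 1"
  have L: "L \<ge> 0" "L0 \<le> L" by (auto simp: L_def)
  have gam1: "gam 1 \<le> gam k" if "k \<ge> 1" for k using mono_onD[OF gam_mono, of 1 k] that by simp
  have scaled: "scaled_branching M (xi k) (psi k) (Z0 k) (g k) (h k) k (gam k) L K1 C" if k: "k \<ge> 1" for k
  proof -
    interpret branching M "xi k" "psi k" "Z0 k" "g k" "h k"
      using indep[OF k] xi_pgf[OF k] psi_pgf[OF k] by unfold_locales auto
    show ?thesis
    proof
      show "1 \<le> k" "0 < gam k" "0 \<le> L" "0 \<le> K1" using k gam_pos[OF k] L condC(1) by auto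
      show "L + K1 + L * K1 / gam k \<le> C"
        unfolding C_def using gam1[OF k] gam_pos[of 1] L condC(1)
        by (intro add_left_mono divide_left_mono) auto
    next
      fix s :: real assume s: "s \<in> {0..1}" "1 - s \<le> 2 / real k"
      have g1: "g k 1 = 1" using xi_pgf[of 1 0 0] by (simp add: prob_space)
      have kp: "real k > 0" using k by simp
      \<comment> \<open>The Lipschitz bound between k * (1 - s) and 0; R_k vanishes at 0 because g k
        1 = 1.\<close>
      have "\<bar>real k * gam k * (g k (1 - (real k * (1 - s)) / real k) - (1 - (real k * (1 - s)) / real k))
          - real k * gam k * (g k (1 - 0 / real k) - (1 - 0 / real k))\<bar> \<le> L0 * \<bar>real k * (1 - s) - 0\<bar>"
        using s kp by (intro L0 k) (auto simp: field_simps)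
      hence "real k * gam k * \<bar>g k s - s\<bar> \<le> L0 * (real k * (1 - s))"
        using kp g1 s gam_pos[OF k] by (simp add: abs_mult)
      hence "gam k * \<bar>g k s - s\<bar> \<le> L0 * (1 - s)" using kp by (simp add: mult.assoc mult.left_commute[of L0])
      also have "\<dots> \<le> L * (1 - s)" using L s by (intro mult_right_mono) auto
      finally show "\<bar>g k s - s\<bar> \<le> L / gam k * (1 - s)"
        using gam_pos[OF k] by (simp add: pos_le_divide_eq mult.commute)
    next
      fix z and s :: real assume s: "s \<in> {0..1}"
      have kp: "real k > 0" using k by simp
      \<comment> \<open>Condition (C) is indexed by real x; the choice x = z / k reaches every
        population size.\<close>
      have "nat \<lfloor>real k * (real z / real k)\<rfloor> = z" using kp by simp
      then obtain D where D: "(deriv (h k z) \<longlongrightarrow> D) (at_left 1)" "gam k / real k * D \<le> K1 * (1 + real z / real k)"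
        using condC(2)[OF k, of "real z / real k"] by auto
      have "1 - h k z s \<le> D * (1 - s)"
        by (rule pgf_le_deriv_at_1[of "\<lambda>w. psi k 0 w z" "h k z" D]) (use psi_pgf D s in auto)
      moreover have "D \<le> real k * K1 / gam k * (1 + real z / real k)"
      proof -
        have "D = real k / gam k * (gam k / real k * D)" using kp gam_pos[OF k] by simp
        also have "\<dots> \<le> real k / gam k * (K1 * (1 + real z / real k))"
          using D(2) kp gam_pos[OF k] by (intro mult_left_mono) auto
        finally show ?thesis by (simp add: mult.assoc)
      qed
      hence "D * (1 - s) \<le> real k * K1 / gam k * (1 + real z / real k) * (1 - s)"
        using s by (intro mult_right_mono) auto
      ultimately show "1 - h k z s \<le> real k * K1 / gam k * (1 + real z / real k) * (1 - s)" by linarith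
    qed
  qed
  obtain m where m: "m \<ge> 0" "\<And>k. k \<ge> 1 \<Longrightarrow> (\<integral>\<^sup>+ w. ennreal (real (Z0 k w) / real k) \<partial>M) \<le> ennreal m"
  proof -
    let ?S = "SUP k\<in>{1..}. \<integral>\<^sup>+ w. ennreal (real (Z0 k w) / real k) \<partial>M"
    have "?S = ennreal (enn2real ?S)" using condD by (simp add: ennreal_enn2real)
    moreover have "(\<integral>\<^sup>+ w. ennreal (real (Z0 k w) / real k) \<partial>M) \<le> ?S" if "k \<ge> 1" for k
      by (rule SUP_upper) (use that in simp)
    ultimately show ?thesis using that[of "enn2real ?S"] by simp
  qed
  have C0: "C \<ge> 0" by (rule scaled_branching.C_nonneg[OF scaled[of 1]]) simp
  show ?thesis
    unfolding skorokhod_tight_def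
  proof (intro allI impI)
    fix e :: real assume e: "e > 0"
    \<comment> \<open>The order of choice matters: \<open>a\<close> meets the containment budget,
      \<open>eta\<close> compensates the factor \<open>exp (a j)\<close>, and \<open>del\<close>
      then makes the oscillation bound small. The summand 1 in the denominator of \<open>del\<close>
      covers the case \<open>B j = 0\<close>. None of these depends on k.\<close>
    define a where "a j = exp (C * real j) * (1 + m) * 2 ^ (j + 2) / e" for j :: nat
    define eta where "eta j = exp (- a j) / real (Suc j)" for j
    define B where "B j = 4 * (1 + a j) * C / (eta j)\<^sup>2" for j
    define del where "del j = e / 2 ^ (j + 2) / (B j * (1 + real j * B j) + 1)" for j
    have a: "a j \<ge> 0" for j unfolding a_def using m e by simp
    have eta: "eta j > 0" "exp (a j) * eta j \<le> 1 / real (Suc j)" for j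
      by (auto simp: eta_def exp_minus)
    have B: "B j \<ge> 0" for j unfolding B_def using a C0 by simp
    have den: "B j * (1 + real j * B j) + 1 > 0" for j using B[of j] by (intro add_nonneg_pos) auto
    have del: "del j > 0" for j unfolding del_def using e den[of j] by simp
    have exceed: "exp (C * real j) * (1 + m) / (1 + a j) \<le> e / 2 ^ (j + 2)" for j
    proof -
      have "exp (C * real j) * (1 + m) = a j * (e / 2 ^ (j + 2))" using e by (simp add: a_def)
      also have "\<dots> \<le> (1 + a j) * (e / 2 ^ (j + 2))" using e by (intro mult_right_mono) auto
      finally show ?thesis using a[of j] by (simp add: pos_divide_le_eq mult.commute)
    qed
    have osc: "del j * B j * (1 + real j * B j) \<le> e / 2 ^ (j + 2)" for j
    proof -
      have "del j * (B j * (1 + real j * B j)) \<le> del j * (B j * (1 + real j * B j) + 1)"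
        using del[of j] by (intro mult_left_mono) auto
      also have "\<dots> = e / 2 ^ (j + 2)" unfolding del_def using den[of j] by simp
      finally show ?thesis by (simp add: mult.assoc)
    qed
    show "\<exists>KK. skorokhod_compact KK \<and>
        (\<forall>k\<ge>1. \<exists>A\<in>sets M. A \<subseteq> {w \<in> space M. Ypath (Zproc (\<lambda>n i. xi k n i w) (\<lambda>n. psi k n w) (Z0 k w)) (gam k) k \<in> KK}
          \<and> 1 - e \<le> measure M A)"
    proof (intro exI[of _ "block_paths del a"] conjI allI impI)
      show "skorokhod_compact (block_paths del a)" by (rule block_paths_compact) (rule del)
      fix k :: nat assume k: "1 \<le> k"
      interpret scaled_branching M "xi k" "psi k" "Z0 k" "g k" "h k" k "gam k" L K1 C
        by (rule scaled[OF k])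
      show "\<exists>A\<in>sets M. A \<subseteq> {w \<in> space M. Ypath (Zproc (\<lambda>n i. xi k n i w) (\<lambda>n. psi k n w) (Z0 k w)) (gam k) k \<in> block_paths del a}
          \<and> 1 - e \<le> measure M A"
        using block_paths_prob[OF m(2)[OF k] m(1) e a eta del exceed osc[unfolded B_def]]
        unfolding Zp_def .
    qed
  qed
qed

end
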